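(* Let $\mathcal{A}=(\mathcal{A},\mathfrak{m}_{\mathcal A},\mathsf{k})$ be a local Artinian algebra over the field $\mathsf{k}$, with $\mathsf{k}=\mathcal{A}/\mathfrak{m}_{\mathcal A}$, and let $M\subset \mathcal{A}^k$ be an $\mathcal{A}$-submodule of a finite free module, with Hilbert function $H(M)$. Then for any $\ell\in\mathfrak{m}_{\mathcal A}$ the Jordan type of multiplication by $\ell$ on $M$ satisfies, in the dominance order, $$P_{\ell,M}\leq H(M)^\vee .$$ If, moreover, $\mathcal{A}$ has a weight function $\mathsf{w}$ (that is, a grading $\mathcal{A}=\mathcal{A}(\mathsf{w})=\bigoplus_{i\ge 0}\mathcal{A}_{i(\mathsf{w})}$) for which $\mathcal{A}_{0(\mathsf{w})}=\mathsf{k}$, and if $M$ is a graded module over $\mathcal{A}(\mathsf{w})$ with $\mathsf{w}$-Hilbert function $H_{\mathsf{w}}(M)$, then for any $\mathsf{w}$-homogeneous element $\ell\in\mathfrak{m}_{\mathcal A}$ the Jordan type also satisfies $$P_{\ell,M}\leq H_{\mathsf{w}}(M)^\vee .$$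
   Context: $\mathsf{k}$ is an arbitrary field; $\mathcal{A}$ is a commutative local Artinian $\mathsf{k}$-algebra containing its residue field $\mathsf{k}=\mathcal{A}/\mathfrak{m}_{\mathcal A}$, finite dimensional over $\mathsf{k}$. Jordan type: for $\ell\in\mathfrak{m}_{\mathcal A}$ and a finite $\mathcal{A}$-module $M$, $P_{\ell,M}$ is the partition of $\dim_{\mathsf{k}}M$ (parts in non-increasing order) whose parts are the sizes of the Jordan blocks of the nilpotent $\mathsf{k}$-linear map $m_\ell\colon M\to M$, $m_\ell(x)=\ell x$. Hilbert function of $M\subset\mathcal{A}^k$: the order $\nu(a)$ of $0\ne a\in\mathcal{A}$ is the largest $i$ with $a\in\mathfrak{m}_{\mathcal A}^{\,i}$, and the order of an element $(a_1,\dots,a_k)$ of $M$ is the minimum of the orders of its nonzero entries; $H(M)=(h_0,h_1,\dots)$ where $h_i=\dim_{\mathsf{k}}\,(M\cap \mathfrak{m}_{\mathcal A}^{\,i}\mathcal{A}^k)/(M\cap \mathfrak{m}_{\mathcal A}^{\,i+1}\mathcal{A}^k)$, i.e. the Hilbert function for the filtration of $M$ by order. (For $M=\mathcal{A}$ this is the Hilbert function of the associated graded algebra of $\mathcal{A}$.) $\mathsf{w}$-Hilbert function: when $M=\bigoplus_{i\ge0} M_i$ is graded over $\mathcal{A}(\mathsf{w})$, $H_{\mathsf{w}}(M)=(\dim_{\mathsf{k}}M_0,\dim_{\mathsf{k}}M_1,\dots)$. Conjugate of a finite sequence $H=(h_0,h_1,\dots,h_j)$ of non-negative integers: $H^\vee$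 is the partition with parts $h_i^\vee=\#\{u\mid h_u\ge i\}$, $i=1,2,\dots,\max_u h_u$. Dominance order: for partitions $P=(p_1\ge p_2\ge\cdots)$ and $P'=(p_1'\ge p_2'\ge\cdots)$ (extended by zeros), $P\le P'$ means $\sum_{u=1}^i p_u\le\sum_{u=1}^i p'_u$ for all $i$. *)

theory Defs
  imports "Jordan_Normal_Form.Jordan_Normal_Form" "HOL-Library.Function_Algebras"
begin

section \<open>Partitions\<close>

text \<open>Partitions are non-increasing lists of positive integers.\<close>

definition partition :: "nat list \<Rightarrow> bool" where
  "partition P \<longleftrightarrow> sorted_wrt (\<ge>) P \<and> 0 \<notin> set P"

text \<open>\<open>take i P = P\<close> for large \<open>i\<close>, so this is the dominance order for partitions
  extended by zeros.\<close>

definition dominance_le :: "nat list \<Rightarrow> nat list \<Rightarrow> bool" (infix "\<unlhd>" 50) where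
  "P \<unlhd> Q \<longleftrightarrow> (\<forall>i. sum_list (take i P) \<le> sum_list (take i Q))"

text \<open>A finite sequence \<open>(h\<^sub>0, \<dots>, h\<^sub>j)\<close> is given as a function on the naturals that vanishes
  beyond \<open>j\<close>; the trailing zeros do not affect the conjugate.\<close>

definition conjugate_seq :: "(nat \<Rightarrow> nat) \<Rightarrow> nat list" where
  "conjugate_seq h = map (\<lambda>i. card {u. h u \<ge> i}) [1..<Suc (Max (range h))]"

section \<open>Linear algebra\<close>

text \<open>The vector spaces below are subspaces of a type with scalar multiplication \<open>scale\<close>.\<close>

text \<open>The dimension of \<open>V / W\<close>: the size of a set of representatives in \<open>V\<close> of a basis
  of \<open>V / W\<close>.\<close>

definition quot_dim :: "('k::field \<Rightarrow> 'b::ab_group_add \<Rightarrow> 'b) \<Rightarrow> 'b set \<Rightarrow> 'b set \<Rightarrow> nat" where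
  "quot_dim scale V W = card (SOME B. finite B \<and> B \<subseteq> V \<and>
     (\<forall>v\<in>V. \<exists>!c. (\<forall>b. b \<notin> B \<longrightarrow> c b = 0) \<and> v - (\<Sum>b\<in>B. scale (c b) b) \<in> W))"

definition basis_list :: "('k::field \<Rightarrow> 'b::ab_group_add \<Rightarrow> 'b) \<Rightarrow> 'b set \<Rightarrow> 'b list \<Rightarrow> bool" where
  "basis_list scale V bs \<longleftrightarrow>
     distinct bs \<and> \<not> Modules.module.dependent scale (set bs) \<and> Modules.module.span scale (set bs) = V"

text \<open>Column \<open>j\<close> holds the coordinates of the image of the \<open>j\<close>-th basis vector.\<close>

definition matrix_wrt ::
    "('k::field \<Rightarrow> 'b::ab_group_add \<Rightarrow> 'b) \<Rightarrow> 'b list \<Rightarrow> ('b \<Rightarrow> 'b) \<Rightarrow> 'k mat" where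
  "matrix_wrt scale bs f = mat (length bs) (length bs)
     (\<lambda>(i, j). Modules.module.representation scale (set bs) (f (bs ! j)) (bs ! i))"

text \<open>This is meant for a nilpotent linear map \<open>f\<close> of a finite-dimensional space \<open>V\<close> to
  itself; accordingly all Jordan blocks have eigenvalue \<open>0\<close>.\<close>

definition jordan_type ::
    "('k::field \<Rightarrow> 'b::ab_group_add \<Rightarrow> 'b) \<Rightarrow> 'b set \<Rightarrow> ('b \<Rightarrow> 'b) \<Rightarrow> nat list" where
  "jordan_type scale V f = (THE P. partition P \<and>
     (\<exists>bs. basis_list scale V bs \<and>
       jordan_nf (matrix_wrt scale bs f) (map (\<lambda>p. (p, 0)) P)))"

definition direct_sum_decomp ::
    "('k::field \<Rightarrow> 'b::ab_group_add \<Rightarrow> 'b) \<Rightarrow> 'b set \<Rightarrow> (nat \<Rightarrow> 'b set) \<Rightarrow> bool" where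
  "direct_sum_decomp scale V G \<longleftrightarrow> (\<forall>i. Modules.module.subspace scale (G i) \<and> G i \<subseteq> V) \<and>
     (\<forall>v\<in>V. \<exists>!c. (\<forall>i. c i \<in> G i) \<and> finite {i. c i \<noteq> 0} \<and> v = (\<Sum>i | c i \<noteq> 0. c i))"

lemma (in vector_space) quot_dim_eq_diff:
  assumes V: "subspace V" and W: "subspace W" and WV: "W \<subseteq> V"
    and S: "finite S" "V \<subseteq> span S"
  shows "quot_dim scale V W = dim V - dim W"
proof -
  define good where "good B \<longleftrightarrow> finite B \<and> B \<subseteq> V \<and>
     (\<forall>v\<in>V. \<exists>!c. (\<forall>b. b \<notin> B \<longrightarrow> c b = 0) \<and> v - (\<Sum>b\<in>B. scale (c b) b) \<in> W)" for B
  obtain C where C: "C \<subseteq> W" "independent C" "W \<subseteq> span C" "card C = dim W"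
    using basis_exists by blast
  have finC: "finite C"
    using independent_span_bound[OF S(1) C(2)] C(1) WV S(2) by blast
  have spC: "span C = W" using C W span_minimal by blast
  have card_good: "card B = dim V - dim W" if "good B" for B
  proof -
    have finB: "finite B" and BV: "B \<subseteq> V"
      and ex1: "\<And>v. v \<in> V \<Longrightarrow> \<exists>!c. (\<forall>b. b \<notin> B \<longrightarrow> c b = 0) \<and> v - (\<Sum>b\<in>B. scale (c b) b) \<in> W"
      using that by (auto simp: good_def)
    have zero: "c b = 0" if "(\<Sum>b\<in>B. scale (c b) b) \<in> W" "b \<in> B" for c b
    proof -
      define c' where "c' = (\<lambda>b. if b \<in> B then c b else 0)"
      have "(\<Sum>b\<in>B. scale (c' b) b) = (\<Sum>b\<in>B. scale (c b) b)"
        by (rule sum.cong) (auto simp: c'_def)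
      then have "0 - (\<Sum>b\<in>B. scale (c' b) b) \<in> W"
        using that(1) W subspace_neg by simp
      moreover have "0 - (\<Sum>b\<in>B. scale (0::'a) b) \<in> W"
        using subspace_0[OF W] by simp
      ultimately have "c' = (\<lambda>_. 0)"
        using ex1[OF subspace_0[OF V]] by (auto simp: c'_def)
      then show ?thesis using that(2) by (metis c'_def)
    qed
    have disj: "B \<inter> C = {}"
    proof (rule ccontr)
      assume "B \<inter> C \<noteq> {}"
      then obtain x where x: "x \<in> B" "x \<in> C" by blast
      have "(\<Sum>b\<in>B. scale (if b = x then 1 else 0) b) = (\<Sum>b\<in>B. if b = x then b else 0)"
        by (rule sum.cong) auto
      also have "\<dots> = x" using finB x by simp
      finally show False using zero[of "\<lambda>b. if b = x then 1 else 0" x] x C(1) by auto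
    qed
    have "independent (B \<union> C)"
    proof (rule independent_if_scalars_zero)
      show "finite (B \<union> C)" using finB finC by simp
    next
      fix f x assume sum0: "(\<Sum>y\<in>B \<union> C. scale (f y) y) = 0" and x: "x \<in> B \<union> C"
      have eq: "(\<Sum>y\<in>B. scale (f y) y) + (\<Sum>y\<in>C. scale (f y) y) = 0"
        using sum0 by (simp add: sum.union_disjoint finB finC disj)
      have inW: "(\<Sum>y\<in>C. scale (f y) y) \<in> W"
        using C(1) W by (intro subspace_sum subspace_scale) auto
      then have "(\<Sum>y\<in>B. scale (f y) y) \<in> W"
        using eq W subspace_neg by (metis add_eq_0_iff2)
      then have fB: "f b = 0" if "b \<in> B" for b using zero that by blast
      then have "(\<Sum>y\<in>C. scale (f y) y) = 0" using eq by simp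
      then have "f c = 0" if "c \<in> C" for c using independentD[OF C(2) finC subset_refl] that by blast
      with fB x show "f x = 0" by blast
    qed
    moreover have "V \<subseteq> span (B \<union> C)"
    proof
      fix v assume "v \<in> V"
      then obtain c where "v - (\<Sum>b\<in>B. scale (c b) b) \<in> W" using ex1 by blast
      then have "v - (\<Sum>b\<in>B. scale (c b) b) \<in> span (B \<union> C)"
        using spC span_mono[of C "B \<union> C"] by auto
      moreover have "(\<Sum>b\<in>B. scale (c b) b) \<in> span (B \<union> C)"
        by (intro span_sum span_scale span_base) auto
      ultimately show "v \<in> span (B \<union> C)" using span_add by fastforce
    qed
    moreover have "B \<union> C \<subseteq> V" using BV C(1) WV by blast
    ultimately have "dim V = card (B \<union> C)" using basis_card_eq_dim by metis
    then show ?thesis using card_Un_disjoint[OF finB finC disj] C(4) by simp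
  qed
  obtain D where D: "C \<subseteq> D" "D \<subseteq> V" "independent D" "V \<subseteq> span D"
    using maximal_independent_subset_extend[of C V] C(1,2) WV by blast
  have finD: "finite D" using independent_span_bound[OF S(1) D(3)] D(2) S(2) by blast
  have "good (D - C)"
    unfolding good_def
  proof (intro conjI ballI)
    show "finite (D - C)" "D - C \<subseteq> V" using finD D by auto
    fix v assume v: "v \<in> V"
    have split: "(\<Sum>b\<in>D. scale (g b) b) = (\<Sum>b\<in>D - C. scale (g b) b) + (\<Sum>b\<in>C. scale (g b) b)" for g
      using sum.subset_diff[OF D(1) finD] by blast
    have "v \<in> span D" using v D by blast
    then obtain g where g: "v = (\<Sum>b\<in>D. scale (g b) b)"
      using span_finite[OF finD] by auto
    show "\<exists>!c. (\<forall>b. b \<notin> D - C \<longrightarrow> c b = 0) \<and> v - (\<Sum>b\<in>D - C. scale (c b) b) \<in> W"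
    proof (rule ex_ex1I)
      have "(\<Sum>b\<in>D - C. scale ((if b \<in> D - C then g b else 0)) b) = (\<Sum>b\<in>D - C. scale (g b) b)"
        by (rule sum.cong) auto
      moreover have "(\<Sum>b\<in>C. scale (g b) b) \<in> W"
        using C(1) W by (intro subspace_sum subspace_scale) auto
      ultimately show "\<exists>c. (\<forall>b. b \<notin> D - C \<longrightarrow> c b = 0) \<and> v - (\<Sum>b\<in>D - C. scale (c b) b) \<in> W"
        using g split[of g] by (intro exI[of _ "\<lambda>b. if b \<in> D - C then g b else 0"]) simp
    next
      fix c d
      assume c: "(\<forall>b. b \<notin> D - C \<longrightarrow> c b = 0) \<and> v - (\<Sum>b\<in>D - C. scale (c b) b) \<in> W"
        and d: "(\<forall>b. b \<notin> D - C \<longrightarrow> d b = 0) \<and> v - (\<Sum>b\<in>D - C. scale (d b) b) \<in> W"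
      have "(v - (\<Sum>b\<in>D - C. scale (c b) b)) - (v - (\<Sum>b\<in>D - C. scale (d b) b)) \<in> W"
        using c d W subspace_diff by blast
      then have "(\<Sum>b\<in>D - C. scale (d b - c b) b) \<in> span C"
        by (simp add: spC scale_left_diff_distrib sum_subtractf)
      then obtain h where h: "(\<Sum>b\<in>D - C. scale (d b - c b) b) = (\<Sum>b\<in>C. scale (h b) b)"
        using span_finite[OF finC] by auto
      define g' where "g' b = (if b \<in> C then - h b else d b - c b)" for b
      have "(\<Sum>b\<in>D. scale (g' b) b) = (\<Sum>b\<in>D - C. scale (d b - c b) b) + (\<Sum>b\<in>C. scale (- h b) b)"
        unfolding split by (intro arg_cong2[where f = "(+)"] sum.cong) (auto simp: g'_def)
      then have "(\<Sum>b\<in>D. scale (g' b) b) = 0" by (simp add: h sum_negf)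
      then have "g' b = 0" if "b \<in> D" for b
        using independentD[OF D(3) finD subset_refl] that by blast
      then have "d b = c b" if "b \<in> D - C" for b using that by (force simp: g'_def)
      then show "c = d" using c d by (metis ext)
    qed
  qed
  then have "good (SOME B. good B)" by (rule someI)
  then show ?thesis using card_good unfolding quot_dim_def good_def[symmetric] by blast
qed

section \<open>Ideals, tuples and the Hilbert function\<close>

text \<open>Ideals of a commutative ring are the submodules of the ring over itself.\<close>

abbreviation is_ideal :: "'a::comm_ring_1 set \<Rightarrow> bool" where
  "is_ideal \<equiv> Modules.module.subspace (*)"

definition is_maximal_ideal :: "'a::comm_ring_1 set \<Rightarrow> bool" where
  "is_maximal_ideal I \<longleftrightarrow> is_ideal I \<and> I \<noteq> UNIV \<and>
     (\<forall>J. is_ideal J \<and> I \<subseteq> J \<and> J \<noteq> UNIV \<longrightarrow> J = I)"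

text \<open>The submodule \<open>I \<cdot> N\<close> generated by the products \<open>a \<cdot> x\<close> with \<open>a \<in> I\<close> and \<open>x \<in> N\<close>;
  \<open>act\<close> is the scalar multiplication of the ambient module.\<close>

definition ideal_mult ::
    "('a::comm_ring_1 \<Rightarrow> 'b::ab_group_add \<Rightarrow> 'b) \<Rightarrow> 'a set \<Rightarrow> 'b set \<Rightarrow> 'b set" where
  "ideal_mult act I N = Modules.module.span act {act a x | a x. a \<in> I \<and> x \<in> N}"

primrec ideal_power :: "'a::comm_ring_1 set \<Rightarrow> nat \<Rightarrow> 'a set" where
  "ideal_power I 0 = UNIV"
| "ideal_power I (Suc i) = ideal_mult (*) I (ideal_power I i)"

text \<open>Elements of \<open>A\<^sup>n\<close> are functions on the naturals that vanish outside \<open>{..<n}\<close>.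
  Scalars act entrywise: the ring \<open>A\<close> by \<open>tuple_scale (*)\<close>, the ground field by
  \<open>tuple_scale scale\<close>.\<close>

definition free_mod :: "nat \<Rightarrow> (nat \<Rightarrow> 'a::zero) set" where
  "free_mod n = {x. \<forall>i\<ge>n. x i = 0}"

definition tuple_scale :: "('c \<Rightarrow> 'a \<Rightarrow> 'a) \<Rightarrow> 'c \<Rightarrow> (nat \<Rightarrow> 'a) \<Rightarrow> nat \<Rightarrow> 'a" where
  "tuple_scale s c x = (\<lambda>i. s c (x i))"

lemma vector_space_tuple_scale:
  assumes "vector_space s"
  shows "vector_space (tuple_scale s)"
proof -
  interpret vector_space s by fact
  show ?thesis
    by unfold_locales
      (auto simp: tuple_scale_def fun_eq_iff scale_right_distrib scale_left_distrib)
qed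

lemma module_tuple_scale_mult: "Modules.module (tuple_scale ((*) :: 'a::comm_ring_1 \<Rightarrow> 'a \<Rightarrow> 'a))"
  by unfold_locales (auto simp: tuple_scale_def fun_eq_iff algebra_simps)

definition submodule_of_free :: "nat \<Rightarrow> (nat \<Rightarrow> 'a::comm_ring_1) set \<Rightarrow> bool" where
  "submodule_of_free n M \<longleftrightarrow> M \<subseteq> free_mod n \<and> Modules.module.subspace (tuple_scale (*)) M"

text \<open>Intersection of \<open>M\<close> with \<open>m\<^sup>i A\<^sup>n\<close>, i.e. the elements of \<open>M\<close> of order at least \<open>i\<close>.\<close>

definition order_filtration ::
    "'a::comm_ring_1 set \<Rightarrow> nat \<Rightarrow> (nat \<Rightarrow> 'a) set \<Rightarrow> nat \<Rightarrow> (nat \<Rightarrow> 'a) set" where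
  "order_filtration m n M i = M \<inter> ideal_mult (tuple_scale (*)) (ideal_power m i) (free_mod n)"

definition hilbert_function ::
    "('k::field \<Rightarrow> 'a::comm_ring_1 \<Rightarrow> 'a) \<Rightarrow> 'a set \<Rightarrow> nat \<Rightarrow> (nat \<Rightarrow> 'a) set \<Rightarrow> nat \<Rightarrow> nat" where
  "hilbert_function scale m n M i =
     quot_dim (tuple_scale scale)
       (order_filtration m n M i) (order_filtration m n M (Suc i))"

section \<open>Local Artinian algebras and gradings\<close>

text \<open>The assumption \<open>residue_field\<close> says that the structure map \<open>c \<mapsto> c \<cdot> 1\<close> induces a bijection
  from the ground field onto the residue field \<open>A / m\<close>.\<close>

locale local_artinian_algebra = vector_space scale
  for scale :: "'k::field \<Rightarrow> 'a::comm_ring_1 \<Rightarrow> 'a" +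
  fixes m :: "'a set"
  assumes scale_mult: "scale c x * y = scale c (x * y)"
    and maximal_iff: "is_maximal_ideal I \<longleftrightarrow> I = m"
    and artinian: "(\<And>i. is_ideal (J i :: 'a set)) \<Longrightarrow> (\<And>i. J (Suc i) \<subseteq> J i) \<Longrightarrow> \<exists>N. \<forall>i\<ge>N. J i = J N"
    and residue_field: "\<exists>!c. a - scale c 1 \<in> m"
    and finite_dim: "\<exists>B. finite B \<and> span B = UNIV"

definition algebra_grading ::
    "('k::field \<Rightarrow> 'a::comm_ring_1 \<Rightarrow> 'a) \<Rightarrow> (nat \<Rightarrow> 'a set) \<Rightarrow> bool" where
  "algebra_grading scale G \<longleftrightarrow> direct_sum_decomp scale UNIV G \<and>
     (\<forall>i j. \<forall>a\<in>G i. \<forall>b\<in>G j. a * b \<in> G (i + j))"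

text \<open>\<open>N\<close> makes \<open>M\<close> a graded module over the algebra graded by \<open>G\<close>. This is an arbitrary
  grading, not necessarily induced from one of the ambient free module.\<close>

definition module_grading ::
    "('k::field \<Rightarrow> 'a::comm_ring_1 \<Rightarrow> 'a) \<Rightarrow> (nat \<Rightarrow> 'a set) \<Rightarrow>
     (nat \<Rightarrow> 'a) set \<Rightarrow> (nat \<Rightarrow> (nat \<Rightarrow> 'a) set) \<Rightarrow> bool" where
  "module_grading scale G M N \<longleftrightarrow>
     direct_sum_decomp (tuple_scale scale) M N \<and>
     (\<forall>i j. \<forall>a\<in>G i. \<forall>x\<in>N j. tuple_scale (*) a x \<in> N (i + j))"

definition weighted_hilbert_function ::
    "('k::field \<Rightarrow> 'a::comm_ring_1 \<Rightarrow> 'a) \<Rightarrow> (nat \<Rightarrow> (nat \<Rightarrow> 'a) set) \<Rightarrow> nat \<Rightarrow> nat" where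
  "weighted_hilbert_function scale N i = vector_space.dim (tuple_scale scale) (N i)"

definition mult_jordan_type ::
    "('k::field \<Rightarrow> 'a::comm_ring_1 \<Rightarrow> 'a) \<Rightarrow> 'a \<Rightarrow> (nat \<Rightarrow> 'a) set \<Rightarrow> nat list" where
  "mult_jordan_type scale l M =
     jordan_type (tuple_scale scale) M (tuple_scale (*) l)"

end

theory Submission
  imports Defs
    "Jordan_Normal_Form.Jordan_Normal_Form_Existence"
    "Jordan_Normal_Form.Jordan_Normal_Form_Uniqueness"
begin

text \<open>
  Both inequalities are instances of one statement about a linear map \<open>f\<close> on a finite-dimensional
  space with a descending filtration \<open>V\<^sub>0 \<supseteq> V\<^sub>1 \<supseteq> \<dots> \<supseteq> V\<^sub>s = 0\<close> such that \<open>f V\<^sub>j \<subseteq> V\<^sub>j\<^sub>+\<^sub>1\<close>: if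
  \<open>dim V\<^sub>j - dim V\<^sub>j\<^sub>+\<^sub>1 \<le> h\<^sub>j\<close>, then the Jordan type of \<open>f\<close> on \<open>V\<^sub>0\<close> is dominated by the conjugate of
  \<open>h\<close> (\<open>jordan_type_dominance_le_conjugate_seq\<close>).

  To see this, fix \<open>i\<close> and let \<open>W\<close> be spanned by the \<open>i\<close> largest Jordan blocks. It is invariant, its
  dimension is the sum of the first \<open>i\<close> parts of the Jordan type, and the kernel of \<open>f\<close> on \<open>W\<close> has
  dimension at most \<open>i\<close>. Put \<open>W\<^sub>j = W \<inter> V\<^sub>j\<close>. The quotient \<open>W\<^sub>j / W\<^sub>j\<^sub>+\<^sub>1\<close> embeds into
  \<open>V\<^sub>j / V\<^sub>j\<^sub>+\<^sub>1\<close>, so its dimension is at most \<open>h\<^sub>j\<close>. It is also a quotient of \<open>W\<^sub>j / f W\<^sub>j\<close>, because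
  \<open>f W\<^sub>j \<subseteq> W\<^sub>j\<^sub>+\<^sub>1\<close>, and by rank-nullity \<open>W\<^sub>j / f W\<^sub>j\<close> has the dimension of the kernel of \<open>f\<close> on \<open>W\<^sub>j\<close>,
  which is at most \<open>i\<close>. Hence \<open>dim W \<le> \<Sum>\<^sub>j min i h\<^sub>j\<close> (\<open>dim_invariant_le_sum_min\<close>), and counting
  the cells of the first \<open>i\<close> columns of the diagram with rows \<open>h\<^sub>j\<close> shows that the right-hand side is
  the sum of the first \<open>i\<close> parts of the conjugate.

  The Jordan type is a definite description, so it also has to be shown to exist and to be unique
  (\<open>jordan_type_spec\<close>). A basis adapted to the filtration makes the matrix of \<open>f\<close> strictly upper
  triangular, which gives existence over an arbitrary field; uniqueness holds because matrices in
  different bases are similar and the dimensions of generalised eigenspaces count the blocks.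

  For the Hilbert function, \<open>V\<^sub>j = M \<inter> m\<^sup>j A\<^sup>n\<close>: multiplication by an element of \<open>m\<close> raises the order,
  and the filtration reaches \<open>0\<close> because \<open>m\<close> is nilpotent, by Nakayama's lemma applied to the power
  at which the powers of \<open>m\<close> become stationary. For the weighted Hilbert function, \<open>V\<^sub>j\<close> is the sum
  of the components of \<open>M\<close> of degree at least \<open>j\<close>: a homogeneous element of positive degree raises the
  degree, and an element of \<open>m\<close> of degree \<open>0\<close> is a scalar in \<open>m\<close>, hence \<open>0\<close>.
\<close>

section \<open>Dimensions inside a finitely generated space\<close>

context vector_space
begin

text \<open>The coordinates of \<open>x\<close> in the basis \<open>D\<close> are supported in \<open>C\<close> and also outside \<open>C\<close>.\<close>

lemma span_Int_span_Diff:
  assumes "independent D" "C \<subseteq> D" "x \<in> span C" "x \<in> span (D - C)"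
  shows "x = 0"
proof -
  have "representation D x = representation C x" "representation D x = representation (D - C) x"
    using assms by (auto intro: representation_extend)
  then have "representation D x b = 0" for b
    using representation_ne_zero[of C x b] representation_ne_zero[of "D - C" x b] by fastforce
  moreover have "x \<in> span D" using assms span_mono[of C D] by blast
  ultimately show ?thesis
    using sum_nonzero_representation_eq[OF assms(1)] by fastforce
qed

lemma finite_basis_extend:
  assumes "finite S" "V \<subseteq> span S" "subspace V" "subspace W" "W \<subseteq> V"
  obtains C D where "finite D" "C \<subseteq> D" "independent D" "span C = W" "span D = V"
proof -
  obtain C where C: "C \<subseteq> W" "independent C" "W \<subseteq> span C"
    using maximal_independent_subset by blast
  have "C \<subseteq> V" using C(1) assms(5) by (rule subset_trans)
  then obtain D where D: "C \<subseteq> D" "D \<subseteq> V" "independent D" "V \<subseteq> span D"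
    using C(2) by (rule maximal_independent_subset_extend)
  show thesis
  proof
    show "finite D" using independent_span_bound[OF assms(1) D(3)] D(2) assms(2) by blast
    show "span C = W" "span D = V" using C D span_minimal assms(3,4) by blast+
  qed (fact D)+
qed

lemma dim_mono_subset:
  assumes "finite S" "V \<subseteq> span S" "W \<subseteq> V"
  shows "dim W \<le> dim V"
proof -
  obtain C where C: "C \<subseteq> W" "independent C" "W \<subseteq> span C"
    using maximal_independent_subset by blast
  obtain D where D: "D \<subseteq> V" "independent D" "V \<subseteq> span D"
    using maximal_independent_subset by blast
  have "finite D" using independent_span_bound[OF assms(1) D(2)] D(1) assms(2) by blast
  then have "card C \<le> card D" using independent_span_bound[OF _ C(2), of D] C(1) D(3) assms(3) by blast
  then show ?thesis using C D basis_card_eq_dim by metis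
qed

text \<open>Equivalently, \<open>A / (A \<inter> B)\<close> embeds into \<open>V / B\<close>. A basis \<open>E\<close> of \<open>B\<close> together with the part
  \<open>D - C\<close> of a basis of \<open>A\<close> lying outside \<open>A \<inter> B\<close> stays independent. The ambient type may have
  infinite dimension; only \<open>V\<close> is assumed to lie in a finitely generated space, here and below.\<close>

lemma dim_submodular:
  assumes fin: "finite S" "V \<subseteq> span S" and sub: "subspace A" "subspace B"
    and le: "A \<subseteq> V" "B \<subseteq> V"
  shows "dim A + dim B \<le> dim V + dim (A \<inter> B)"
proof -
  have AB: "subspace (A \<inter> B)" using sub by (rule subspace_inter)
  obtain C D where D: "finite D" "C \<subseteq> D" "independent D" "span C = A \<inter> B" "span D = A"
    by (rule finite_basis_extend[OF fin(1) _ sub(1) AB]) (use le fin(2) in auto)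
  obtain C' E where E: "finite E" "C' \<subseteq> E" "independent E" "span C' = A \<inter> B" "span E = B"
    by (rule finite_basis_extend[OF fin(1) _ sub(2) AB]) (use le fin(2) in auto)
  have meet0: "x = 0" if "x \<in> span (D - C)" "x \<in> span E" for x
  proof -
    have "x \<in> A" using that(1) D(5) span_mono[of "D - C" D] by blast
    then show ?thesis using span_Int_span_Diff[OF D(3,2)] that D(4) E(5) by blast
  qed
  have disj: "(D - C) \<inter> E = {}"
  proof (rule ccontr)
    assume "(D - C) \<inter> E \<noteq> {}"
    then obtain x where "x \<in> D - C" "x \<in> E" by blast
    then show False using meet0[of x] span_base E(3) dependent_zero by metis
  qed
  have "independent ((D - C) \<union> E)"
  proof (rule independent_if_scalars_zero)
    show "finite ((D - C) \<union> E)" using D E by simp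
  next
    fix g x assume s0: "(\<Sum>y\<in>(D - C) \<union> E. g y *s y) = 0" and x: "x \<in> (D - C) \<union> E"
    have eq: "(\<Sum>y\<in>D - C. g y *s y) + (\<Sum>y\<in>E. g y *s y) = 0"
      using s0 D(1) E(1) disj by (subst (asm) sum.union_disjoint) auto
    have 1: "(\<Sum>y\<in>D - C. g y *s y) \<in> span (D - C)" and 2: "(\<Sum>y\<in>E. g y *s y) \<in> span E"
      by (auto intro: span_sum span_scale span_base)
    have "(\<Sum>y\<in>D - C. g y *s y) = - (\<Sum>y\<in>E. g y *s y)"
      using eq by (simp add: eq_neg_iff_add_eq_0)
    then have "(\<Sum>y\<in>D - C. g y *s y) \<in> span E" using span_neg[OF 2] by simp
    then have z: "(\<Sum>y\<in>D - C. g y *s y) = 0" using meet0[OF 1] by blast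
    with eq have z': "(\<Sum>y\<in>E. g y *s y) = 0" by simp
    show "g x = 0"
      using independentD[OF D(3) _ _ z] independentD[OF E(3) E(1) subset_refl z'] x D(1) by blast
  qed
  moreover have "(D - C) \<union> E \<subseteq> V" using span_superset[of D] span_superset[of E] D(5) E(5) le by blast
  ultimately have "card ((D - C) \<union> E) \<le> dim V"
    using dim_mono_subset[OF fin] dim_eq_card_independent by metis
  moreover have "card ((D - C) \<union> E) = card (D - C) + card E"
    using disj D(1) E(1) by (intro card_Un_disjoint) auto
  moreover have "card D = card C + card (D - C)"
    using D(1,2) card_Diff_subset[of C D] card_mono[of D C] finite_subset[of C D] by force
  moreover have "card D = dim A" "card E = dim B" "card C = dim (A \<inter> B)"
    using D E dim_span_eq_card_independent independent_mono by metis+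
  ultimately show ?thesis by linarith
qed

text \<open>After extending a basis \<open>C\<close> of the kernel in \<open>U\<close> to a basis \<open>D\<close> of \<open>U\<close>, the map is injective on the
  span of \<open>D - C\<close> and has the same image there as on \<open>U\<close>.\<close>

lemma rank_nullity_subspace:
  assumes lin: "Vector_Spaces.linear scale scale f"
    and fin: "finite S" "U \<subseteq> span S" and U: "subspace U"
  shows "dim U = dim (f ` U) + dim (U \<inter> {x. f x = 0})"
proof -
  interpret f: Vector_Spaces.linear scale scale f by fact
  have K: "subspace (U \<inter> {x. f x = 0})" using U f.subspace_kernel by (rule subspace_inter)
  obtain C D where D: "finite D" "C \<subseteq> D" "independent D" "span C = U \<inter> {x. f x = 0}" "span D = U"
    by (rule finite_basis_extend[OF fin U K]) auto
  have inj: "inj_on f (span (D - C))"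
    unfolding f.inj_on_iff_eq_0[OF subspace_span]
  proof (intro ballI impI)
    fix x assume x: "x \<in> span (D - C)" "f x = 0"
    then have "x \<in> U" using D(5) span_mono[of "D - C" D] by blast
    then show "x = 0" using span_Int_span_Diff[OF D(3,2)] x D(4) by blast
  qed
  have ind: "independent (f ` (D - C))"
    using f.independent_injective_image[OF _ inj] D(3) independent_mono by blast
  have "f ` D \<subseteq> insert 0 (f ` (D - C))" using D(4) span_base[of _ C] by blast
  then have "span (f ` D) \<subseteq> span (f ` (D - C))" using span_mono span_insert_0 by metis
  moreover have "span (f ` (D - C)) \<subseteq> span (f ` D)" by (intro span_mono) auto
  ultimately have "f ` U = span (f ` (D - C))" using f.span_image D(5) by auto
  then have "dim (f ` U) = card (f ` (D - C))" using dim_span_eq_card_independent[OF ind] by simp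
  also have "\<dots> = card (D - C)" using inj inj_on_subset span_superset card_image by metis
  finally have "dim (f ` U) = card (D - C)" .
  moreover have "card D = card C + card (D - C)"
    using D(1,2) card_Diff_subset[of C D] card_mono[of D C] finite_subset[of C D] by force
  moreover have "card D = dim U" "card C = dim (U \<inter> {x. f x = 0})"
    using D dim_span_eq_card_independent independent_mono by metis+
  ultimately show ?thesis by linarith
qed

lemma subspace_eq_if_dim_le:
  assumes "finite S" "V \<subseteq> span S" "subspace V" "subspace W" "W \<subseteq> V" "dim V \<le> dim W"
  shows "W = V"
proof -
  obtain C D where D: "finite D" "C \<subseteq> D" "independent D" "span C = W" "span D = V"
    by (rule finite_basis_extend[OF assms(1-5)])
  have "card C = dim W" "card D = dim V"
    using D dim_span_eq_card_independent independent_mono by metis+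
  then have "C = D" using D(1,2) assms(6) by (intro card_seteq) auto
  then show ?thesis using D by simp
qed

lemma finite_spanning_subset:
  assumes "finite S" "V \<subseteq> span S"
  obtains B where "finite B" "B \<subseteq> V" "V \<subseteq> span B" "card B = dim V"
proof -
  obtain B where B: "B \<subseteq> V" "independent B" "V \<subseteq> span B" "card B = dim V"
    by (rule basis_exists)
  moreover have "finite B" using independent_span_bound[OF assms(1) B(2)] B(1) assms(2) by blast
  ultimately show thesis using that by blast
qed

lemma dim_span_Un_le:
  assumes "finite S" "A \<subseteq> span S" "B \<subseteq> span S"
  shows "dim (span (A \<union> B)) \<le> dim A + dim B"
proof -
  obtain A' where A': "finite A'" "A' \<subseteq> A" "A \<subseteq> span A'" "card A' = dim A"
    using assms(1,2) by (rule finite_spanning_subset)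
  obtain B' where B': "finite B'" "B' \<subseteq> B" "B \<subseteq> span B'" "card B' = dim B"
    using assms(1,3) by (rule finite_spanning_subset)
  have "A \<union> B \<subseteq> span (A' \<union> B')"
    using A'(3) B'(3) span_mono[of A' "A' \<union> B'"] span_mono[of B' "A' \<union> B'"] by blast
  then have "span (A \<union> B) \<subseteq> span (A' \<union> B')" by (rule span_minimal) simp
  then have "dim (span (A \<union> B)) \<le> card (A' \<union> B')" using A'(1) B'(1) by (intro dim_le_card) auto
  also have "\<dots> \<le> card A' + card B'" by (rule card_Un_le)
  finally show ?thesis using A'(4) B'(4) by simp
qed

text \<open>Otherwise some element is redundant and the remaining ones still span \<open>V\<close>, which is impossible with
  fewer than \<open>dim V\<close> vectors.\<close>

lemma independent_if_spanning_card_le_dim: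
  assumes "finite B" "V \<subseteq> span B" "card B \<le> dim V"
  shows "independent B"
proof
  assume "dependent B"
  then obtain a where a: "a \<in> B" "a \<in> span (B - {a})" by (auto simp: dependent_def)
  then have "V \<subseteq> span (B - {a})"
    using span_redundant[OF a(2)] assms(2) by (simp add: insert_absorb)
  then have "dim V \<le> card (B - {a})" using assms(1) by (intro dim_le_card) auto
  then show False using a(1) assms(1,3) by (metis card_Diff1_less not_le order_trans)
qed

section \<open>The dimension bound for a filtered nilpotent map\<close>

text \<open>The heart of the argument. The condition \<open>dim W \<le> dim (f ` W) + i\<close> says, by rank-nullity, that
  the kernel of \<open>f\<close> on \<open>W\<close> has dimension at most \<open>i\<close>. This passes to the subspaces \<open>W \<inter> V j\<close>, which is
  why it bounds every step of the induced filtration of \<open>W\<close> and not only the first.\<close>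

lemma dim_invariant_le_sum_min:
  assumes lin: "Vector_Spaces.linear scale scale f"
    and fin: "finite S" "V 0 \<subseteq> span S"
    and V: "\<And>j. subspace (V j)" "\<And>j. V (Suc j) \<subseteq> V j" "\<And>j. f ` V j \<subseteq> V (Suc j)" "V s \<subseteq> {0}"
    and W: "subspace W" "W \<subseteq> V 0" "f ` W \<subseteq> W" "dim W \<le> dim (f ` W) + i"
  shows "dim W \<le> (\<Sum>j<s. min i (dim (V j) - dim (V (Suc j))))"
proof -
  have finV: "V j \<subseteq> span S" for j
    using lift_Suc_antimono_le[of V 0 j] V(2) fin(2) by auto
  have finW: "W \<inter> V j \<subseteq> span S" for j using finV by blast
  have sub: "subspace (W \<inter> V j)" for j using W(1) V(1) by (rule subspace_inter)
  have step: "dim (W \<inter> V j) \<le> dim (W \<inter> V (Suc j)) + min i (dim (V j) - dim (V (Suc j)))" for j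
  proof -
    \<comment> \<open>The bound by the step of the filtration of the whole space.\<close>
    have "dim (W \<inter> V j) + dim (V (Suc j)) \<le> dim (V j) + dim ((W \<inter> V j) \<inter> V (Suc j))"
      using dim_submodular[OF fin(1) finV sub V(1) _ V(2)] by blast
    moreover have "(W \<inter> V j) \<inter> V (Suc j) = W \<inter> V (Suc j)" using V(2) by blast
    ultimately have 1: "dim (W \<inter> V j) \<le> dim (W \<inter> V (Suc j)) + (dim (V j) - dim (V (Suc j)))"
      by simp
    \<comment> \<open>The bound by \<open>i\<close>: the image of \<open>W \<inter> V j\<close> lies one step further down.\<close>
    have "dim (W \<inter> V j) = dim (f ` (W \<inter> V j)) + dim (W \<inter> V j \<inter> {x. f x = 0})"
      by (rule rank_nullity_subspace[OF lin fin(1) finW sub])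
    also have "dim (f ` (W \<inter> V j)) \<le> dim (W \<inter> V (Suc j))"
      using W(3) V(3) by (intro dim_mono_subset[OF fin(1) finW]) blast
    also have "dim (W \<inter> V j \<inter> {x. f x = 0}) \<le> dim (W \<inter> {x. f x = 0})"
      using W(2) fin(2) by (intro dim_mono_subset[OF fin(1)]) blast+
    also have "dim (W \<inter> {x. f x = 0}) \<le> i"
      using rank_nullity_subspace[OF lin fin(1) _ W(1)] W(2,4) fin(2) by force
    finally show ?thesis using 1 by simp
  qed
  have "dim (W \<inter> V 0) \<le> dim (W \<inter> V t) + (\<Sum>j<t. min i (dim (V j) - dim (V (Suc j))))" for t
  proof (induction t)
    case (Suc t)
    then show ?case using step[of t] by simp
  qed simp
  from this[of s] have "dim W \<le> dim (W \<inter> V s) + (\<Sum>j<s. min i (dim (V j) - dim (V (Suc j))))"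
    using W(2) by (simp add: Int_absorb2)
  moreover have "dim (W \<inter> V s) = 0"
    using dim_le_card[of "W \<inter> V s" "{}"] V(4) by auto
  ultimately show ?thesis by simp
qed

end

text \<open>Double counting of the pairs \<open>(u, j)\<close> with \<open>1 \<le> u \<le> i\<close> and \<open>u \<le> h j\<close>. For \<open>u\<close> beyond the
  maximum of \<open>h\<close> there are none, so it does not matter that the conjugate ends there.\<close>

lemma sum_min_le_sum_list_take_conjugate_seq:
  assumes h: "\<And>j. j \<ge> s \<Longrightarrow> h j = 0"
  shows "(\<Sum>j<s. min i (h j)) \<le> sum_list (take i (conjugate_seq h))"
proof -
  have fr: "finite (range h)"
  proof (rule finite_subset)
    show "range h \<subseteq> insert 0 (h ` {..<s})" using h by (auto simp: not_less[symmetric])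
  qed simp
  define mx where "mx = Max (range h)"
  have hmx: "h j \<le> mx" for j using fr by (auto simp: mx_def)
  have "take i (conjugate_seq h) = map (\<lambda>u. card {j. h j \<ge> u}) [1..<Suc (min i mx)]"
    unfolding conjugate_seq_def mx_def[symmetric] take_map
    by (cases "i \<le> mx") (auto simp: take_upt simp del: upt_Suc)
  then have "sum_list (take i (conjugate_seq h)) = (\<Sum>u\<in>{1..min i mx}. card {j. h j \<ge> u})"
    by (simp add: sum_list_distinct_conv_sum_set atLeastLessThanSuc_atLeastAtMost del: upt_Suc)
  also have "\<dots> = (\<Sum>u\<in>{1..min i mx}. \<Sum>j<s. if h j \<ge> u then 1 else 0)"
  proof (rule sum.cong[OF refl])
    fix u assume "u \<in> {1..min i mx}"
    then have "j < s" if "h j \<ge> u" for j using h[of j] that by (cases "j < s") auto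
    then have "{j. h j \<ge> u} = {j\<in>{..<s}. h j \<ge> u}" by auto
    then show "card {j. h j \<ge> u} = (\<Sum>j<s. if h j \<ge> u then 1 else 0)"
      by (simp add: sum.If_cases Int_def)
  qed
  also have "\<dots> = (\<Sum>j<s. \<Sum>u\<in>{1..min i mx}. if h j \<ge> u then 1 else 0)" by (rule sum.swap)
  also have "\<dots> = (\<Sum>j<s. min i (h j))"
  proof (rule sum.cong[OF refl])
    fix j
    have "{1..min i mx} \<inter> {u. u \<le> h j} = {1..min i (h j)}" using hmx[of j] by auto
    then show "(\<Sum>u\<in>{1..min i mx}. if h j \<ge> u then 1 else 0) = min i (h j)"
      by (simp add: sum.If_cases)
  qed
  finally show ?thesis by simp
qed

section \<open>Jordan matrices up to the order of their blocks\<close>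

text \<open>Conjugation by the permutation matrix that exchanges two groups of coordinates.\<close>

lemma similar_jordan_matrix_append_commute:
  "similar_mat (jordan_matrix (xs @ ys)) (jordan_matrix (ys @ xs) :: 'a::field mat)"
proof -
  let ?n = "sum_list (map fst xs)" and ?m = "sum_list (map fst ys)"
  define A where "A = (jordan_matrix xs :: 'a mat)"
  define B where "B = (jordan_matrix ys :: 'a mat)"
  have A: "A \<in> carrier_mat ?n ?n" and B: "B \<in> carrier_mat ?m ?m" by (simp_all add: A_def B_def)
  have split: "jordan_matrix (us @ vs) = four_block_mat (jordan_matrix us)
      (0\<^sub>m (sum_list (map fst us)) (sum_list (map fst vs)))
      (0\<^sub>m (sum_list (map fst vs)) (sum_list (map fst us))) (jordan_matrix vs :: 'a mat)"
    for us vs :: "(nat \<times> 'a) list"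
    using jordan_matrix_dim[of us] jordan_matrix_dim[of vs]
    by (simp add: jordan_matrix_def diag_block_mat_append Let_def)
  define swap :: "nat \<Rightarrow> nat \<Rightarrow> 'a mat"
    where "swap a b = four_block_mat (0\<^sub>m a b) (1\<^sub>m a) (1\<^sub>m b) (0\<^sub>m b a)" for a b
  have inv: "swap a b * swap b a = 1\<^sub>m (a + b)" for a b
    unfolding swap_def by (subst mult_four_block_mat[where ?n1.0 = b and ?n2.0 = a]) auto
  have car: "swap a b \<in> carrier_mat (a + b) (b + a)" for a b unfolding swap_def by auto
  have "swap ?n ?m * four_block_mat B (0\<^sub>m ?m ?n) (0\<^sub>m ?n ?m) A
      = four_block_mat (0\<^sub>m ?n ?m) A B (0\<^sub>m ?m ?n)"
    unfolding swap_def using A B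
    by (subst mult_four_block_mat[where ?n1.0 = ?m and ?n2.0 = ?n]) auto
  also have "\<dots> * swap ?m ?n = four_block_mat A (0\<^sub>m ?n ?m) (0\<^sub>m ?m ?n) B"
    unfolding swap_def using A B
    by (subst mult_four_block_mat[where ?n1.0 = ?m and ?n2.0 = ?n]) auto
  finally have eq: "four_block_mat A (0\<^sub>m ?n ?m) (0\<^sub>m ?m ?n) B =
      swap ?n ?m * four_block_mat B (0\<^sub>m ?m ?n) (0\<^sub>m ?n ?m) A * swap ?m ?n" by simp
  show ?thesis
    unfolding split A_def[symmetric] B_def[symmetric]
  proof (rule similar_matI[where P = "swap ?n ?m" and Q = "swap ?m ?n" and n = "?n + ?m"])
    show "{four_block_mat A (0\<^sub>m ?n ?m) (0\<^sub>m ?m ?n) B, four_block_mat B (0\<^sub>m ?m ?n) (0\<^sub>m ?n ?m) A,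
        swap ?n ?m, swap ?m ?n} \<subseteq> carrier_mat (?n + ?m) (?n + ?m)"
      using car[of ?n ?m] car[of ?m ?n] A B by (auto simp: add.commute)
    show "swap ?m ?n * swap ?n ?m = 1\<^sub>m (?n + ?m)" using inv[of ?m ?n] by (simp add: add.commute)
  qed (fact inv eq)+
qed

text \<open>Exchanging the two halves of the list and permuting its tail already generate all rearrangements:
  if \<open>x\<close> occurs in \<open>ys = us @ x # vs\<close>, exchange the halves to obtain \<open>x # vs @ us\<close>.\<close>

lemma similar_jordan_matrix_mset_eq:
  assumes "mset xs = mset ys"
  shows "similar_mat (jordan_matrix xs) (jordan_matrix ys :: 'a::field mat)"
  using assms
proof (induction xs arbitrary: ys)
  case Nil
  then show ?case using similar_mat_refl[OF jordan_matrix_carrier] by simp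
next
  case (Cons x xs)
  then have "x \<in> set ys" by (metis list.set_intros(1) set_mset_mset)
  then obtain us vs where ys: "ys = us @ x # vs" by (meson split_list)
  have xs: "mset xs = mset (vs @ us)" using Cons.prems ys by (simp add: union_commute)
  obtain p a where x: "x = (p, a)" by force
  have "similar_mat (jordan_matrix (x # xs)) (jordan_matrix (x # vs @ us))"
    using similar_mat_four_block_0_0[OF similar_mat_refl[OF jordan_block_carrier] Cons.IH[OF xs]
        jordan_block_carrier jordan_matrix_carrier, of p a]
      arg_cong[OF xs, of "\<lambda>M. sum_mset (image_mset fst M)"]
    by (simp add: x jordan_matrix_Cons sum_mset_sum_list flip: mset_map)
  also have "x # vs @ us = (x # vs) @ us" by simp
  finally show ?case
    using similar_mat_trans similar_jordan_matrix_append_commute[of "x # vs" us] ys by metis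
qed

text \<open>The number of blocks of size \<open>k\<close> is a similarity invariant, since it is computed from the dimensions
  of generalised eigenspaces. Multisets of parts determine partitions because these are sorted.\<close>

lemma partition_eq_if_similar:
  fixes A B :: "'a::field mat"
  assumes "partition P" "partition Q" "similar_mat A B"
    and A: "jordan_nf A (map (\<lambda>p. (p, 0)) P)" and B: "jordan_nf B (map (\<lambda>p. (p, 0)) Q)"
  shows "P = Q"
proof -
  have "jordan_nf A (map (\<lambda>p. (p, 0)) Q)"
    using B assms(3) similar_mat_trans by (auto simp: jordan_nf_def)
  note * = compute_nr_of_jordan_blocks[OF A] compute_nr_of_jordan_blocks[OF this]
  have "count (mset P) k = count (mset Q) k" for k
  proof (cases "k = 0")
    case True
    then show ?thesis using assms(1,2) by (metis partition_def count_mset_0_iff)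
  next
    case False
    have "length (filter ((=) (k, 0)) (map (\<lambda>p. (p, 0::'a)) R)) = count (mset R) k" for R
      by (induction R) auto
    then show ?thesis using *[OF False, of 0] by metis
  qed
  then have "mset P = mset Q" by (rule multiset_eqI)
  moreover have "sorted (rev R)" if "partition R" for R
    using that by (simp add: partition_def sorted_wrt_rev)
  ultimately have "rev P = rev Q"
    using assms(1,2) by (metis mset_rev properties_for_sort)
  then show ?thesis by simp
qed

text \<open>The coordinates at which a Jordan block starts, together with the size of the matrix.\<close>

definition block_boundaries :: "nat list \<Rightarrow> nat set" where
  "block_boundaries P = (\<lambda>u. sum_list (take u P)) ` {..length P}"

lemma block_boundaries_Cons:
  "b \<in> block_boundaries (p # P) \<longleftrightarrow> b = 0 \<or> p \<le> b \<and> b - p \<in> block_boundaries P"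
proof -
  have "{..length (p # P)} = insert 0 (Suc ` {..length P})"
    using atMost_Suc_eq_insert_0 by simp
  then have "b \<in> block_boundaries (p # P) \<longleftrightarrow> b = 0 \<or> (\<exists>u\<le>length P. b = p + sum_list (take u P))"
    by (auto simp: block_boundaries_def image_iff)
  then show ?thesis by (auto simp: block_boundaries_def image_iff Bex_def le_iff_add)
qed

text \<open>The ones of a nilpotent Jordan matrix stand directly above the diagonal, except in the columns where
  a new block starts.\<close>

lemma jordan_matrix_nilpotent_index:
  assumes "a < sum_list P" "b < sum_list P"
  shows "jordan_matrix (map (\<lambda>p. (p, 0)) P) $$ (a, b) =
    (if Suc a = b \<and> b \<notin> block_boundaries P then 1 else (0::'a::field))"
  using assms
proof (induction P arbitrary: a b)
  case (Cons p P)
  have s: "sum_list (map fst (map (\<lambda>p. (p, 0::'a)) P)) = sum_list P"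
    by (simp add: comp_def)
  have 0: "0 \<in> block_boundaries P" by (auto simp: block_boundaries_def image_iff intro: bexI[of _ 0])
  have "jordan_matrix (map (\<lambda>p. (p, 0)) (p # P)) $$ (a, b) =
    (if a < p then if b < p then jordan_block p 0 $$ (a, b) else 0
     else if b < p then 0 else jordan_matrix (map (\<lambda>p. (p, 0::'a)) P) $$ (a - p, b - p))"
    using Cons.prems
    by (simp add: jordan_matrix_Cons s comp_def)
  also have "\<dots> = (if Suc a = b \<and> b \<notin> block_boundaries (p # P) then 1 else 0)"
    using Cons.IH[of "a - p" "b - p"] Cons.prems 0
    by (auto simp: block_boundaries_Cons Suc_diff_le)
  finally show ?case .
qed simp

section \<open>Existence and uniqueness of the Jordan type\<close>

text \<open>The matrix of \<open>g\<close> with respect to two bases; with the identity map it is a change of basis, and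
  for \<open>cs = bs\<close> it is the matrix of an endomorphism.\<close>

definition coord_mat ::
    "('k::field \<Rightarrow> 'b::ab_group_add \<Rightarrow> 'b) \<Rightarrow> 'b list \<Rightarrow> 'b list \<Rightarrow> ('b \<Rightarrow> 'b) \<Rightarrow> 'k mat" where
  "coord_mat scale cs bs g = mat (length cs) (length bs)
     (\<lambda>(i, j). Modules.module.representation scale (set cs) (g (bs ! j)) (cs ! i))"

context vector_space
begin

lemma coord_mat_carrier: "coord_mat scale cs bs g \<in> carrier_mat (length cs) (length bs)"
  by (simp add: coord_mat_def)

lemma sum_set_eq_sum_nth:
  assumes "distinct cs"
  shows "(\<Sum>c\<in>set cs. h c) = (\<Sum>i<length cs. h (cs ! i))"
  using sum.reindex_bij_betw[OF bij_betw_nth[OF assms refl refl], of h] by (simp add: atLeast0LessThan)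

lemma coord_mat_comp:
  assumes g: "Vector_Spaces.linear scale scale g"
    and cs: "distinct cs" "independent (set cs)" and ds: "independent (set ds)"
    and h: "\<And>b. b \<in> set bs \<Longrightarrow> h b \<in> span (set cs)"
    and gc: "\<And>c. c \<in> set cs \<Longrightarrow> g c \<in> span (set ds)"
  shows "coord_mat scale ds cs g * coord_mat scale cs bs h = coord_mat scale ds bs (\<lambda>x. g (h x))"
proof (rule eq_matI)
  interpret g: Vector_Spaces.linear scale scale g by fact
  fix i j assume "i < dim_row (coord_mat scale ds bs (\<lambda>x. g (h x)))"
    "j < dim_col (coord_mat scale ds bs (\<lambda>x. g (h x)))"
  then have ij: "i < length ds" "j < length bs" by (simp_all add: coord_mat_def)
  have hj: "h (bs ! j) \<in> span (set cs)" using h ij(2) by simp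
  have "representation (set ds) (g (h (bs ! j))) (ds ! i) =
      representation (set ds) (g (\<Sum>c\<in>set cs. representation (set cs) (h (bs ! j)) c *s c)) (ds ! i)"
    using sum_representation_eq[OF cs(2) hj] by simp
  also have "\<dots> = (\<Sum>c\<in>set cs. representation (set cs) (h (bs ! j)) c * representation (set ds) (g c) (ds ! i))"
    by (simp add: g.sum g.scale representation_sum[OF ds] representation_scale[OF ds] gc span_scale)
  finally show "(coord_mat scale ds cs g * coord_mat scale cs bs h) $$ (i, j) = coord_mat scale ds bs (\<lambda>x. g (h x)) $$ (i, j)"
    using ij
    by (simp add: coord_mat_def scalar_prod_def sum_set_eq_sum_nth[OF cs(1)] atLeast0LessThan mult.commute)
qed (simp_all add: coord_mat_def)

lemma coord_mat_self:
  assumes "distinct bs" "independent (set bs)"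
  shows "coord_mat scale bs bs (\<lambda>x. x) = 1\<^sub>m (length bs)"
  using assms by (intro eq_matI) (auto simp: coord_mat_def representation_basis nth_eq_iff_index_eq)

lemma linear_ident: "Vector_Spaces.linear scale scale (\<lambda>x. x)"
  by unfold_locales simp_all

lemma basis_list_length:
  assumes "basis_list scale V bs"
  shows "length bs = dim V"
  using assms dim_span_eq_card_independent distinct_card by (metis basis_list_def)

lemma similar_matrix_wrt:
  assumes f: "Vector_Spaces.linear scale scale f" "f ` V \<subseteq> V"
    and bs: "basis_list scale V bs" and cs: "basis_list scale V cs"
  shows "similar_mat (matrix_wrt scale bs f) (matrix_wrt scale cs f)"
proof -
  have b: "distinct bs" "independent (set bs)" "span (set bs) = V"
    and c: "distinct cs" "independent (set cs)" "span (set cs) = V"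
    using bs cs by (auto simp: basis_list_def)
  have len: "length cs = length bs" using basis_list_length bs cs by metis
  have mem: "x \<in> V" "f x \<in> V" if "x \<in> set bs \<or> x \<in> set cs" for x
    using that b(3) c(3) span_superset f(2) by blast+
  have eq: "matrix_wrt scale xs f = coord_mat scale xs xs f" for xs
    by (simp add: matrix_wrt_def coord_mat_def)
  show ?thesis
    unfolding eq
  proof (rule similar_matI[where P = "coord_mat scale bs cs (\<lambda>x. x)" and Q = "coord_mat scale cs bs (\<lambda>x. x)"
        and n = "length bs"])
    show "coord_mat scale bs cs (\<lambda>x. x) * coord_mat scale cs bs (\<lambda>x. x) = 1\<^sub>m (length bs)"
      using coord_mat_comp[OF linear_ident c(1,2) b(2), of bs "\<lambda>x. x"] mem
      by (simp add: b c coord_mat_self)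
    show "coord_mat scale cs bs (\<lambda>x. x) * coord_mat scale bs cs (\<lambda>x. x) = 1\<^sub>m (length bs)"
      using coord_mat_comp[OF linear_ident b(1,2) c(2), of cs "\<lambda>x. x"] mem
      by (simp add: b c coord_mat_self len)
    have "coord_mat scale bs cs (\<lambda>x. x) * coord_mat scale cs cs f = coord_mat scale bs cs f"
      using coord_mat_comp[OF linear_ident c(1,2) b(2), of cs f] mem by (simp add: b c)
    then show "coord_mat scale bs bs f = coord_mat scale bs cs (\<lambda>x. x) * coord_mat scale cs cs f * coord_mat scale cs bs (\<lambda>x. x)"
      using coord_mat_comp[OF f(1) c(1,2) b(2), of bs "\<lambda>x. x"] mem by (simp add: b c)
  qed (use len coord_mat_carrier in \<open>metis insert_subset empty_subsetI\<close>)
qed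

text \<open>Bases of the members of the filtration are extended successively, starting from the smallest one. A
  vector added for \<open>V j\<close> is mapped into \<open>V (Suc j)\<close>, which the earlier vectors span.\<close>

lemma triangular_basis_list:
  assumes fin: "finite S" "V 0 \<subseteq> span S"
    and V: "\<And>j. subspace (V j)" "\<And>j. V (Suc j) \<subseteq> V j" "\<And>j. f ` V j \<subseteq> V (Suc j)" "V s \<subseteq> {0}"
  shows "\<exists>bs. basis_list scale (V 0) bs \<and> (\<forall>j<length bs. f (bs ! j) \<in> span (set (take j bs)))"
proof -
  have finV: "V j \<subseteq> span S" for j
    using lift_Suc_antimono_le[of V 0 j] V(2) fin(2) by auto
  have "0 \<le> s" by simp
  then show ?thesis
  proof (induction rule: inc_induct)
    case base
    have "V s = {0}" using V(1,4) subspace_0 by blast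
    then have "basis_list scale (V s) []" by (simp add: basis_list_def independent_empty)
    then show ?case by force
  next
    case (step j)
    then obtain bs where bs: "basis_list scale (V (Suc j)) bs"
      "\<And>k. k < length bs \<Longrightarrow> f (bs ! k) \<in> span (set (take k bs))" by blast
    then have b: "distinct bs" "independent (set bs)" "span (set bs) = V (Suc j)"
      by (auto simp: basis_list_def)
    have "set bs \<subseteq> V j" using span_superset b(3) V(2) by blast
    then obtain D where D: "set bs \<subseteq> D" "D \<subseteq> V j" "independent D" "V j \<subseteq> span D"
      using b(2) by (rule maximal_independent_subset_extend)
    have "finite D" using independent_span_bound[OF fin(1) D(3)] D(2) finV by blast
    then obtain cs where cs: "set cs = D - set bs" "distinct cs"
      using finite_distinct_list[of "D - set bs"] by blast
    have "set (bs @ cs) = D" using cs D(1) by auto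
    moreover have "span D = V j" using D V(1) span_minimal by blast
    ultimately have "basis_list scale (V j) (bs @ cs)"
      using D(3) b(1) cs by (auto simp: basis_list_def)
    moreover have "f ((bs @ cs) ! k) \<in> span (set (take k (bs @ cs)))" if "k < length (bs @ cs)" for k
    proof (cases "k < length bs")
      case True
      then show ?thesis using bs(2) by (simp add: nth_append)
    next
      case False
      then have "(bs @ cs) ! k \<in> V j" using that cs(1) D(2) nth_mem[of "k - length bs" cs]
        by (auto simp: nth_append)
      then have "f ((bs @ cs) ! k) \<in> span (set bs)" using V(3) b(3) by blast
      then show ?thesis using False span_mono[of "set bs" "set (take k (bs @ cs))"] by auto
    qed
    ultimately show ?case by blast
  qed
qed

text \<open>A triangular matrix has a Jordan normal form over any field. The diagonal is zero here, so \<open>0\<close> is the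
  only root of the characteristic polynomial and hence the only eigenvalue of a block. Sorting the
  blocks turns the list of their sizes into a partition.\<close>

lemma jordan_nf_exists_of_triangular:
  assumes bs: "basis_list scale V bs" and tri: "\<And>j. j < length bs \<Longrightarrow> f (bs ! j) \<in> span (set (take j bs))"
  shows "\<exists>P. partition P \<and> jordan_nf (matrix_wrt scale bs f) (map (\<lambda>p. (p, 0)) P)"
proof -
  let ?A = "matrix_wrt scale bs f" and ?n = "length bs"
  have b: "distinct bs" "independent (set bs)" using bs by (auto simp: basis_list_def)
  have A: "?A \<in> carrier_mat ?n ?n" by (simp add: matrix_wrt_def)
  have zero: "?A $$ (i, j) = 0" if "i < ?n" "j \<le> i" for i j
  proof -
    have j: "j < ?n" using that by simp
    have "representation (set bs) (f (bs ! j)) = representation (set (take j bs)) (f (bs ! j))"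
      by (rule representation_extend[OF b(2) tri[OF j] set_take_subset])
    moreover have "bs ! i \<notin> set (take j bs)"
      using that b(1) by (auto simp: in_set_conv_nth nth_eq_iff_index_eq)
    ultimately show ?thesis
      using that j representation_ne_zero[of "set (take j bs)"] by (auto simp: matrix_wrt_def)
  qed
  have "upper_triangular ?A" using zero A by (auto simp: upper_triangular_def)
  then obtain xs where xs: "jordan_nf ?A xs" and
    cp: "char_poly ?A = (\<Prod>a\<leftarrow>diag_mat ?A. [:- a, 1:])"
    using triangular_to_jnf_vector[OF A] char_poly_upper_triangular[OF A] by blast
  have diag: "a = 0" if "a \<in> set (diag_mat ?A)" for a
    using that zero A by (auto simp: diag_mat_def)
  have ev: "a = 0" if "(p, a) \<in> set xs" for p a
  proof -
    have p: "p \<noteq> 0" using xs that by (force simp: jordan_nf_def)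
    have "0 = poly (\<Prod>(n, a)\<leftarrow>xs. [:- a, 1:] ^ n) a"
      using that p by (auto simp: poly_prod_list prod_list_zero_iff image_iff zero_power intro!: bexI[of _ "(p, a)"])
    also have "\<dots> = poly (\<Prod>a\<leftarrow>diag_mat ?A. [:- a, 1:]) a"
      using jordan_nf_char_poly[OF xs] cp by simp
    finally show "a = 0" using diag by (auto simp: poly_prod_list prod_list_zero_iff)
  qed
  define P where "P = rev (sort (map fst xs))"
  have "xs = map (\<lambda>p. (p, 0)) (map fst xs)"
    using ev by (auto simp: map_idI[symmetric] intro!: map_idI[symmetric])
  then have "mset xs = mset (map (\<lambda>p. (p, 0)) P)"
    by (metis P_def mset_map mset_rev mset_sort)
  then have "similar_mat (jordan_matrix xs) (jordan_matrix (map (\<lambda>p. (p, 0)) P))"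
    by (rule similar_jordan_matrix_mset_eq)
  moreover have P0: "0 \<notin> set P" using xs by (auto simp: P_def jordan_nf_def)
  ultimately have "jordan_nf ?A (map (\<lambda>p. (p, 0)) P)"
    using xs similar_mat_trans by (auto simp: jordan_nf_def)
  moreover have "partition P"
    using P0 by (simp add: partition_def P_def sorted_wrt_rev)
  ultimately show ?thesis by blast
qed

text \<open>This allows the definite description that defines the Jordan type to be used.\<close>

lemma jordan_type_spec:
  assumes f: "Vector_Spaces.linear scale scale f"
    and fin: "finite S" "V 0 \<subseteq> span S"
    and V: "\<And>j. subspace (V j)" "\<And>j. V (Suc j) \<subseteq> V j" "\<And>j. f ` V j \<subseteq> V (Suc j)" "V s \<subseteq> {0}"
  shows "\<exists>bs. basis_list scale (V 0) bs \<and>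
    jordan_nf (matrix_wrt scale bs f) (map (\<lambda>p. (p, 0)) (jordan_type scale (V 0) f))"
proof -
  define J where "J P \<longleftrightarrow> partition P \<and> (\<exists>bs. basis_list scale (V 0) bs \<and>
    jordan_nf (matrix_wrt scale bs f) (map (\<lambda>p. (p, 0)) P))" for P
  have fV: "f ` V 0 \<subseteq> V 0" using V(2,3) by blast
  have "\<exists>P. J P"
    using triangular_basis_list[where f = f, OF fin V] jordan_nf_exists_of_triangular
    unfolding J_def by meson
  moreover have "P = Q" if "J P" "J Q" for P Q
  proof -
    from that obtain bs cs where *: "partition P" "partition Q"
      and bs: "basis_list scale (V 0) bs" "jordan_nf (matrix_wrt scale bs f) (map (\<lambda>p. (p, 0)) P)"
      and cs: "basis_list scale (V 0) cs" "jordan_nf (matrix_wrt scale cs f) (map (\<lambda>p. (p, 0)) Q)"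
      unfolding J_def by blast
    show ?thesis
      by (rule partition_eq_if_similar[OF * similar_matrix_wrt[OF f fV bs(1) cs(1)] bs(2) cs(2)])
  qed
  ultimately have "J (THE P. J P)" by (metis theI)
  then show ?thesis by (simp add: J_def jordan_type_def)
qed

end

section \<open>Jordan bases and the dominance order\<close>

lemma sum_list_take_mono:
  assumes "u \<le> v"
  shows "sum_list (take u P) \<le> sum_list (take v (P :: nat list))"
proof -
  have "take v P = take u P @ take (v - u) (drop u P)" using assms take_add[of u "v - u" P] by simp
  then show ?thesis by simp
qed

context vector_space
begin

text \<open>If \<open>A X = X J\<close> with \<open>X\<close> invertible, then the columns of \<open>X\<close> are the coordinates of a Jordan basis.
  Its vectors are numbered consecutively through all blocks, and \<open>f\<close> sends each one to its predecessor
  unless a block starts there.\<close>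

lemma jordan_basis:
  assumes f: "Vector_Spaces.linear scale scale f" "f ` V \<subseteq> V"
    and bs: "basis_list scale V bs"
    and jnf: "jordan_nf (matrix_wrt scale bs f) (map (\<lambda>p. (p, 0)) P)"
  obtains c where "inj_on c {..<sum_list P}" "independent (c ` {..<sum_list P})"
    "c ` {..<sum_list P} \<subseteq> V"
    "\<And>j. j < sum_list P \<Longrightarrow> f (c j) = (if j \<in> block_boundaries P then 0 else c (j - 1))"
proof -
  interpret f: Vector_Spaces.linear scale scale f by fact
  let ?n = "length bs"
  define A where "A = matrix_wrt scale bs f"
  define J :: "'a mat" where "J = jordan_matrix (map (\<lambda>p. (p, 0)) P)"
  have b: "distinct bs" "independent (set bs)" "span (set bs) = V" using bs by (auto simp: basis_list_def)
  have A: "A \<in> carrier_mat ?n ?n" by (simp add: A_def matrix_wrt_def)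
  obtain X Y where wit: "similar_mat_wit A J X Y"
    using jnf by (auto simp: jordan_nf_def similar_mat_def A_def J_def)
  have n: "?n = dim_row A" using A by simp
  note w = similar_mat_witD[OF n wit]
  have nP: "?n = sum_list P" using carrier_matD(1)[OF w(5)] by (simp add: J_def comp_def)
  \<comment> \<open>The vector whose coordinates in the basis \<open>bs\<close> form column \<open>j\<close> of \<open>Z\<close>.\<close>
  define comb where "comb Z j = (\<Sum>i<?n. Z $$ (i, j) *s bs ! i)" for Z j
  have comb_mult: "comb (X * Z) j = (\<Sum>k<?n. Z $$ (k, j) *s comb X k)"
    if "X \<in> carrier_mat ?n ?n" "Z \<in> carrier_mat ?n ?n" "j < ?n" for X Z j
  proof -
    have "comb (X * Z) j = (\<Sum>i<?n. \<Sum>k<?n. (X $$ (i, k) * Z $$ (k, j)) *s bs ! i)"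
      using that by (simp add: comb_def scalar_prod_def scale_sum_left atLeast0LessThan)
    also have "\<dots> = (\<Sum>k<?n. \<Sum>i<?n. (X $$ (i, k) * Z $$ (k, j)) *s bs ! i)" by (rule sum.swap)
    finally show ?thesis by (simp add: comb_def scale_sum_right mult.commute)
  qed
  have fb: "f (bs ! i) = comb A i" if "i < ?n" for i
  proof -
    have "f (bs ! i) \<in> span (set bs)" using that f(2) b(3) span_base[of "bs ! i" "set bs"] by auto
    then show ?thesis
      using sum_representation_eq[OF b(2) _ finite_set subset_refl, of "f (bs ! i)"] that
      by (simp add: comb_def A_def matrix_wrt_def sum_set_eq_sum_nth[OF b(1)])
  qed
  define c where "c = comb X"
  have AX: "A * X = X * J"
  proof -
    have "A * X = X * J * (Y * X)" using w by (simp add: assoc_mult_mat[of _ ?n ?n _ ?n _ ?n])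
    then show ?thesis using w by simp
  qed
  have fc: "f (c j) = (\<Sum>k<?n. J $$ (k, j) *s c k)" if j: "j < ?n" for j
  proof -
    have "f (c j) = (\<Sum>i<?n. X $$ (i, j) *s comb A i)"
      by (simp add: c_def comb_def[of X] f.sum f.scale fb)
    also have "\<dots> = comb (X * J) j" using comb_mult[OF A w(6) j] AX by simp
    finally show ?thesis using comb_mult[OF w(6) w(5) j] by (simp add: c_def)
  qed
  have "bs ! j \<in> span (c ` {..<?n})" if j: "j < ?n" for j
  proof -
    have "comb (1\<^sub>m ?n) j = (\<Sum>i<?n. if i = j then bs ! i else 0)"
      using j unfolding comb_def by (intro sum.cong) auto
    then have "bs ! j = comb (X * Y) j" using j w(1) by simp
    also have "\<dots> = (\<Sum>k<?n. Y $$ (k, j) *s c k)" using comb_mult[OF w(6,7) j] by (simp add: c_def)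
    also have "\<dots> \<in> span (c ` {..<?n})" by (intro span_sum span_scale span_base) auto
    finally show ?thesis .
  qed
  then have "set bs \<subseteq> span (c ` {..<?n})" by (auto simp: in_set_conv_nth)
  then have span: "V \<subseteq> span (c ` {..<?n})" using b(3) span_minimal by blast
  have dimV: "dim V = ?n" using basis_list_length[OF bs] by simp
  have card: "card (c ` {..<?n}) = ?n"
    using dim_le_card[OF span] card_image_le[of "{..<?n}" c] dimV by simp
  show thesis
  proof
    show "inj_on c {..<sum_list P}" using card nP by (intro eq_card_imp_inj_on) auto
    show "independent (c ` {..<sum_list P})"
      using independent_if_spanning_card_le_dim[OF _ span] card dimV nP by simp
    show "c ` {..<sum_list P} \<subseteq> V"
      unfolding c_def comb_def b(3)[symmetric] nP[symmetric]
      by (intro image_subsetI span_sum span_scale span_base) auto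
    fix j assume j: "j < sum_list P"
    have "f (c j) = (\<Sum>k<?n. (if Suc k = j \<and> j \<notin> block_boundaries P then 1 else 0) *s c k)"
      unfolding fc[OF j[folded nP]] J_def
      using j nP by (intro sum.cong) (simp_all add: jordan_matrix_nilpotent_index)
    also have "\<dots> = (\<Sum>k<?n. if k = j - 1 then if j \<notin> block_boundaries P then c k else 0 else 0)"
    proof (rule sum.cong[OF refl])
      fix k
      have "0 \<in> block_boundaries P" by (force simp: block_boundaries_def)
      then show "(if Suc k = j \<and> j \<notin> block_boundaries P then 1 else 0) *s c k =
          (if k = j - 1 then if j \<notin> block_boundaries P then c k else 0 else 0)"
        by (cases j) auto
    qed
    also have "\<dots> = (if j \<in> block_boundaries P then 0 else c (j - 1))"
      using less_imp_diff_less[OF j, of 1] nP by simp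
    finally show "f (c j) = (if j \<in> block_boundaries P then 0 else c (j - 1))" .
  qed
qed

text \<open>The span of the first \<open>i\<close> blocks, which are the \<open>i\<close> largest ones when \<open>P\<close> is a partition. All of its
  basis vectors except the last one of each block are images of other basis vectors, so the
  image loses at most \<open>i\<close> dimensions.\<close>

lemma invariant_subspace_of_largest_blocks:
  assumes f: "Vector_Spaces.linear scale scale f" "f ` V \<subseteq> V" and V: "subspace V"
    and bs: "basis_list scale V bs"
    and jnf: "jordan_nf (matrix_wrt scale bs f) (map (\<lambda>p. (p, 0)) P)"
  obtains W where "subspace W" "W \<subseteq> V" "f ` W \<subseteq> W" "dim W \<le> dim (f ` W) + i"
    "dim W = sum_list (take i P)"
proof -
  interpret f: Vector_Spaces.linear scale scale f by fact
  let ?S = "sum_list (take i P)"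
  obtain c where c: "inj_on c {..<sum_list P}" "independent (c ` {..<sum_list P})"
    "c ` {..<sum_list P} \<subseteq> V"
    "\<And>j. j < sum_list P \<Longrightarrow> f (c j) = (if j \<in> block_boundaries P then 0 else c (j - 1))"
    using f bs jnf by (rule jordan_basis) blast
  have SP: "?S \<le> sum_list P" using sum_list_take_mono[of i "max i (length P)" P] by simp
  define W where "W = span (c ` {..<?S})"
  have card: "card (c ` J) = card J" "independent (c ` J)" if "J \<subseteq> {..<?S}" for J
  proof -
    have J: "J \<subseteq> {..<sum_list P}" using that SP by auto
    show "card (c ` J) = card J" using c(1) J by (meson card_image inj_on_subset)
    show "independent (c ` J)" using c(2) J independent_mono by (meson image_mono)
  qed
  have dimW: "dim W = ?S"
    using dim_span_eq_card_independent[OF card(2)] card(1)[of "{..<?S}"] by (simp add: W_def)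
  have fW: "f ` W = span (f ` c ` {..<?S})" by (simp add: W_def f.span_image)
  have fc: "f (c j) \<in> insert 0 (c ` {..<?S})" if "j < ?S" for j
    using c(4)[of j] that SP by auto
  then have "f ` c ` {..<?S} \<subseteq> W" unfolding W_def
    using fc span_base span_zero by (fastforce simp: W_def)
  then have inv: "f ` W \<subseteq> W" unfolding fW by (rule span_minimal) (simp add: W_def)
  \<comment> \<open>The vector with index \<open>j\<close> is the last one of its block exactly if \<open>Suc j\<close> lies in \<open>E\<close>.\<close>
  define E where "E = (\<lambda>u. sum_list (take u P)) ` {1..i}"
  define K where "K = {j. j < ?S \<and> Suc j \<notin> E}"
  have "c j \<in> f ` W" if "j \<in> K" for j
  proof -
    have j: "j < ?S" "Suc j \<notin> E" using that by (auto simp: K_def)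
    have "i \<noteq> 0" using j(1) by (cases i) auto
    then have "?S \<in> E" by (auto simp: E_def)
    then have lt: "Suc j < ?S" using j by (metis Suc_lessI)
    have "Suc j \<notin> block_boundaries P"
    proof
      assume "Suc j \<in> block_boundaries P"
      then obtain u where u: "Suc j = sum_list (take u P)" by (auto simp: block_boundaries_def)
      have "u \<noteq> 0" using u by (cases u) auto
      then have "i < u" using u j(2) by (force simp: E_def)
      then show False using sum_list_take_mono[of i u P] u lt by simp
    qed
    then have "f (c (Suc j)) = c j" using c(4)[of "Suc j"] lt SP by simp
    then show ?thesis using lt unfolding fW by (auto intro!: span_base rev_image_eqI)
  qed
  then have cK: "c ` K \<subseteq> f ` W" by blast
  have Ks: "K \<subseteq> {..<?S}" by (auto simp: K_def)
  have "card ({..<?S} - K) = card (Suc ` ({..<?S} - K))" by (simp add: card_image)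
  also have "\<dots> \<le> card E" by (rule card_mono) (auto simp: E_def K_def)
  also have "\<dots> \<le> i" using card_image_le[of "{1..i}"] by (simp add: E_def)
  finally have "card ({..<?S} - K) \<le> i" .
  then have "?S \<le> card K + i" using Ks card_Diff_subset[of K "{..<?S}"] finite_subset[OF Ks] by simp
  also have "card K = dim (c ` K)" using card[OF Ks] dim_eq_card_independent by simp
  also have "dim (c ` K) \<le> dim (f ` W)"
    using fW by (intro dim_mono_subset[of "f ` c ` {..<?S}"] cK) auto
  finally have "dim W \<le> dim (f ` W) + i" using dimW by simp
  moreover have "W \<subseteq> V" unfolding W_def using c(3) SP V by (intro span_minimal) auto
  ultimately show thesis using that[of W] inv dimW by (auto simp: W_def)
qed

text \<open>The general theorem: \<open>h\<close> need only bound the steps of the filtration, which spares computing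
  them exactly in the graded case.\<close>

lemma jordan_type_dominance_le_conjugate_seq:
  assumes f: "Vector_Spaces.linear scale scale f"
    and fin: "finite S" "V 0 \<subseteq> span S"
    and V: "\<And>j. subspace (V j)" "\<And>j. V (Suc j) \<subseteq> V j" "\<And>j. f ` V j \<subseteq> V (Suc j)" "V s \<subseteq> {0}"
    and h: "\<And>j. dim (V j) \<le> dim (V (Suc j)) + h j" "\<And>j. j \<ge> s \<Longrightarrow> h j = 0"
  shows "jordan_type scale (V 0) f \<unlhd> conjugate_seq h"
  unfolding dominance_le_def
proof
  fix i
  define P where "P = jordan_type scale (V 0) f"
  have inv: "f ` V 0 \<subseteq> V 0" using V(2,3) by blast
  obtain bs where "basis_list scale (V 0) bs"
    "jordan_nf (matrix_wrt scale bs f) (map (\<lambda>p. (p, 0)) P)"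
    using jordan_type_spec[where f = f, OF f fin V] unfolding P_def by blast
  then obtain W where W: "subspace W" "W \<subseteq> V 0" "f ` W \<subseteq> W" "dim W \<le> dim (f ` W) + i"
    "dim W = sum_list (take i P)"
    by (rule invariant_subspace_of_largest_blocks[OF f inv V(1)])
  have "sum_list (take i P) \<le> (\<Sum>j<s. min i (dim (V j) - dim (V (Suc j))))"
    using dim_invariant_le_sum_min[where f = f and V = V, OF f fin V W(1-4)] W(5) by simp
  also have "\<dots> \<le> (\<Sum>j<s. min i (h j))"
    using h(1) by (intro sum_mono min.mono) (auto simp: le_diff_conv add.commute)
  also have "\<dots> \<le> sum_list (take i (conjugate_seq h))"
    using h(2) by (rule sum_min_le_sum_list_take_conjugate_seq)
  finally show "sum_list (take i (jordan_type scale (V 0) f)) \<le> sum_list (take i (conjugate_seq h))"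
    by (simp add: P_def)
qed

text \<open>A finite spanning set of \<open>V\<close> has only finitely many nonzero components, all of degree below some \<open>s\<close>.
  Then every element of \<open>V\<close> is a sum of components of degree below \<open>s\<close>, and by uniqueness of the
  decomposition an element of a higher component is \<open>0\<close>.\<close>

lemma direct_sum_decomp_bounded:
  assumes G: "direct_sum_decomp scale V G" and fin: "finite S" "V \<subseteq> span S"
  shows "\<exists>s. \<forall>a\<ge>s. G a \<subseteq> {0}"
proof -
  have subG: "subspace (G i)" "G i \<subseteq> V" for i
    using G by (auto simp: direct_sum_decomp_def)
  have uniq: "v \<in> V \<Longrightarrow> \<exists>!c. (\<forall>i. c i \<in> G i) \<and> finite {i. c i \<noteq> 0} \<and> v = (\<Sum>i | c i \<noteq> 0. c i)" for v
    using G by (auto simp: direct_sum_decomp_def)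
  define L where "L s = {v. \<exists>c. (\<forall>i. c i \<in> G i) \<and> (\<forall>i\<ge>s. c i = 0) \<and> v = (\<Sum>i<s. c i)}" for s :: nat
  have L_mono: "L s \<subseteq> L t" if "s \<le> t" for s t
  proof
    fix v assume "v \<in> L s"
    then obtain c where c: "\<And>i. c i \<in> G i" "\<And>i. i \<ge> s \<Longrightarrow> c i = 0" "v = (\<Sum>i<s. c i)"
      by (auto simp: L_def)
    have "(\<Sum>i<s. c i) = (\<Sum>i<t. c i)"
      using that c(2) by (intro sum.mono_neutral_left) auto
    then show "v \<in> L t" unfolding L_def using c that by (intro CollectI exI[of _ c]) auto
  qed
  have L_sub: "subspace (L s)" for s
  proof (rule subspaceI)
    show "0 \<in> L s" unfolding L_def using subG(1)[THEN subspace_0] by (auto intro!: exI[of _ "\<lambda>_. 0"])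
  next
    fix v w assume "v \<in> L s" "w \<in> L s"
    then obtain c d where "\<forall>i. c i \<in> G i" "\<forall>i\<ge>s. c i = 0" "v = (\<Sum>i<s. c i)"
      "\<forall>i. d i \<in> G i" "\<forall>i\<ge>s. d i = 0" "w = (\<Sum>i<s. d i)" by (auto simp: L_def)
    then show "v + w \<in> L s" unfolding L_def
      by (intro CollectI exI[of _ "\<lambda>i. c i + d i"]) (auto simp: sum.distrib subspace_add[OF subG(1)])
  next
    fix k v assume "v \<in> L s"
    then obtain c where "\<forall>i. c i \<in> G i" "\<forall>i\<ge>s. c i = 0" "v = (\<Sum>i<s. c i)" by (auto simp: L_def)
    then show "k *s v \<in> L s" unfolding L_def
      by (intro CollectI exI[of _ "\<lambda>i. k *s c i"]) (auto simp: scale_sum_right subspace_scale[OF subG(1)])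
  qed
  have ex: "\<exists>s. v \<in> L s" if v: "v \<in> V" for v
  proof -
    obtain c where c: "\<forall>i. c i \<in> G i" "finite {i. c i \<noteq> 0}" "v = (\<Sum>i | c i \<noteq> 0. c i)"
      using uniq[OF v] by blast
    then obtain s where s: "{i. c i \<noteq> 0} \<subseteq> {..<s}" using finite_nat_iff_bounded by blast
    then have "(\<Sum>i | c i \<noteq> 0. c i) = (\<Sum>i<s. c i)" by (intro sum.mono_neutral_left) auto
    then have "v \<in> L s" unfolding L_def using c s by (intro CollectI exI[of _ c]) (auto simp: not_less)
    then show ?thesis ..
  qed
  obtain B where B: "finite B" "B \<subseteq> V" "V \<subseteq> span B" "card B = dim V"
    using fin by (rule finite_spanning_subset)
  have "\<exists>s. B \<subseteq> L s" using B(1,2)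
  proof (induction B)
    case (insert b B)
    then obtain s where "B \<subseteq> L s" by auto
    moreover obtain t where "b \<in> L t" using ex insert.prems by auto
    ultimately have "insert b B \<subseteq> L (max s t)" using L_mono[of s "max s t"] L_mono[of t "max s t"] by auto
    then show ?case ..
  qed simp
  then obtain s where "B \<subseteq> L s" ..
  then have VL: "V \<subseteq> L s" using B(3) span_minimal[OF _ L_sub] by blast
  have "x = 0" if a: "a \<ge> s" and x: "x \<in> G a" for a x
  proof -
    define R where "R c \<longleftrightarrow> (\<forall>i. c i \<in> G i) \<and> finite {i. c i \<noteq> 0} \<and> x = (\<Sum>i | c i \<noteq> 0. c i)" for c
    obtain c where c: "\<forall>i. c i \<in> G i" "\<forall>i\<ge>s. c i = 0" "x = (\<Sum>i<s. c i)"
      using VL x subG(2) by (fastforce simp: L_def)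
    have sup: "{i. c i \<noteq> 0} \<subseteq> {..<s}" using c(2) by (auto simp: not_less[symmetric])
    have "(\<Sum>i | c i \<noteq> 0. c i) = (\<Sum>i<s. c i)" using sup by (intro sum.mono_neutral_left) auto
    then have Rc: "R c" unfolding R_def using c finite_subset[OF sup] by simp
    let ?d = "\<lambda>i. if i = a then x else 0"
    have "{i. ?d i \<noteq> 0} \<subseteq> {a}" by auto
    then have "R ?d"
      using x subspace_0[OF subG(1)] finite_subset[of _ "{a}"] by (cases "x = 0") (auto simp: R_def)
    moreover have "x \<in> V" using x subG(2) by blast
    ultimately have "c = ?d" using Rc uniq[of x] unfolding R_def[symmetric] by blast
    then show "x = 0" using c(2) a by (metis (full_types))
  qed
  then show ?thesis by blast
qed

end

section \<open>Ideals of a local Artinian algebra\<close>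

interpretation ring: Modules.module "(*) :: 'a::comm_ring_1 \<Rightarrow> 'a \<Rightarrow> 'a"
  by unfold_locales (simp_all add: algebra_simps)

\<comment> \<open>As a rewrite rule it would undo the associative normal form of products.\<close>
declare ring.scale_scale [simp del]

interpretation tuple: Modules.module "tuple_scale ((*) :: 'a::comm_ring_1 \<Rightarrow> 'a \<Rightarrow> 'a)"
  by (rule module_tuple_scale_mult)

lemma ideal_mult_mono:
  assumes "Modules.module act" "I \<subseteq> I'" "N \<subseteq> N'"
  shows "ideal_mult act I N \<subseteq> ideal_mult act I' N'"
proof -
  interpret Modules.module act by fact
  show ?thesis unfolding ideal_mult_def using assms(2,3) by (intro span_mono) blast
qed

lemma ideal_power_Suc_subset: "ideal_power I (Suc i) \<subseteq> ideal_power I i"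
proof (induction i)
  case (Suc i)
  then show ?case using ideal_mult_mono[OF ring.module_axioms subset_refl] by simp
qed simp

lemma is_ideal_ideal_power: "is_ideal (ideal_power I i)"
  by (cases i) (simp_all add: ideal_mult_def)

context local_artinian_algebra
begin

sublocale tup: vector_space "tuple_scale scale"
  by (rule vector_space_tuple_scale) (rule vector_space_axioms)

lemma subspace_ideal:
  assumes "is_ideal I"
  shows "subspace I"
proof (rule subspaceI)
  fix c x assume "x \<in> I"
  then have "scale c 1 * x \<in> I" using assms by (intro ring.subspace_scale)
  then show "scale c x \<in> I" by (simp add: scale_mult)
qed (use assms ring.subspace_0 ring.subspace_add in blast)+

lemma subspace_tuple_submodule:
  assumes "tuple.subspace N"
  shows "tup.subspace N"
proof (rule tup.subspaceI)
  fix c x assume "x \<in> N"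
  then have "tuple_scale (*) (scale c 1) x \<in> N" using assms by (intro tuple.subspace_scale)
  then show "tuple_scale scale c x \<in> N" by (simp add: tuple_scale_def scale_mult)
qed (use assms tuple.subspace_0 tuple.subspace_add in blast)+

lemma is_ideal_m: "is_ideal m" and one_notin_m: "1 \<notin> m"
proof -
  have m: "is_maximal_ideal m" using maximal_iff by simp
  then show i: "is_ideal m" by (simp add: is_maximal_ideal_def)
  show "1 \<notin> m"
  proof
    assume "1 \<in> m"
    then have "x \<in> m" for x using ring.subspace_scale[OF i, of 1 x] by simp
    then show False using m by (auto simp: is_maximal_ideal_def)
  qed
qed

text \<open>A proper ideal of largest dimension among those that contain \<open>J\<close> is maximal, hence equal to \<open>m\<close>.\<close>

lemma proper_ideal_subset_m:
  assumes J: "is_ideal J" "J \<noteq> UNIV"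
  shows "J \<subseteq> m"
proof -
  obtain S where S: "finite S" "span S = UNIV" using finite_dim by blast
  define Q where "Q K \<longleftrightarrow> is_ideal K \<and> K \<noteq> UNIV \<and> J \<subseteq> K" for K
  have "Q J" using J by (simp add: Q_def)
  moreover have "\<forall>K. Q K \<longrightarrow> dim K < Suc (card S)"
    using S by (auto simp: less_Suc_eq_le intro: dim_le_card)
  ultimately have "\<exists>K. Q K \<and> (\<forall>K'. Q K' \<longrightarrow> dim K' \<le> dim K)" by (rule ex_has_greatest_nat)
  then obtain K where K: "Q K" "\<And>K'. Q K' \<Longrightarrow> dim K' \<le> dim K" by blast
  have "is_maximal_ideal K"
    unfolding is_maximal_ideal_def
  proof (intro conjI allI impI)
    show "is_ideal K" "K \<noteq> UNIV" using K(1) by (auto simp: Q_def)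
    fix K' assume K': "is_ideal K' \<and> K \<subseteq> K' \<and> K' \<noteq> UNIV"
    then have "Q K'" using K(1) by (auto simp: Q_def)
    then have "K = K'"
      using subspace_eq_if_dim_le[OF S(1), of K' K] S(2) K K' by (simp add: Q_def subspace_ideal)
    then show "K' = K" ..
  qed
  then have "K = m" using maximal_iff by blast
  then show ?thesis using K(1) by (simp add: Q_def)
qed

text \<open>The ideal generated by \<open>1 - a\<close> is not contained in \<open>m\<close>, since \<open>1 = (1 - a) + a\<close> is not an
  element of \<open>m\<close>; so it is the whole algebra.\<close>

lemma one_minus_unit:
  assumes "a \<in> m"
  shows "\<exists>b. b * (1 - a) = 1"
proof -
  have "1 - a \<notin> m" using ring.subspace_add[OF is_ideal_m, of "1 - a" a] assms one_notin_m by auto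
  then have "\<not> ring.span {1 - a} \<subseteq> m" using ring.span_base[of "1 - a" "{1 - a}"] by blast
  then have "ring.span {1 - a} = UNIV" using proper_ideal_subset_m[of "ring.span {1 - a}"] by auto
  then have "1 \<in> range (\<lambda>b. b * (1 - a))" using ring.span_singleton[of "1 - a"] by simp
  then show ?thesis by (metis imageE)
qed

text \<open>Removing a generator: \<open>x\<close> is congruent to \<open>a x\<close> with \<open>a \<in> m\<close> modulo the other generators, and
  \<open>1 - a\<close> is a unit, so \<open>x\<close> already lies in the ideal that the others generate.\<close>

lemma nakayama:
  assumes "finite X" "X \<subseteq> ideal_mult (*) m (ring.span X)"
  shows "ring.span X = {0}"
  using assms
proof (induction X rule: finite_induct)
  case (insert x F)
  \<comment> \<open>The sum of the ideals \<open>m x\<close> and \<open>ring.span F\<close>; it contains \<open>m\<close> times the ideal generated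
    by \<open>x\<close> and \<open>F\<close>.\<close>
  define T where "T = {y. \<exists>a\<in>m. y - a * x \<in> ring.span F}"
  have "is_ideal T"
  proof (rule ring.subspaceI)
    show "0 \<in> T" unfolding T_def
      using ring.subspace_0[OF is_ideal_m] ring.span_zero by (auto intro!: bexI[of _ 0])
  next
    fix y z assume "y \<in> T" "z \<in> T"
    then obtain a b where ab: "a \<in> m" "y - a * x \<in> ring.span F" "b \<in> m" "z - b * x \<in> ring.span F"
      by (auto simp: T_def)
    have "(y + z) - (a + b) * x = (y - a * x) + (z - b * x)" by (simp add: algebra_simps)
    also have "\<dots> \<in> ring.span F" by (rule ring.span_add[OF ab(2,4)])
    finally show "y + z \<in> T" unfolding T_def using ring.subspace_add[OF is_ideal_m ab(1,3)] by blast
  next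
    fix c y assume "y \<in> T"
    then obtain a where a: "a \<in> m" "y - a * x \<in> ring.span F" by (auto simp: T_def)
    have "c * y - (c * a) * x = c * (y - a * x)" by (simp add: algebra_simps)
    also have "\<dots> \<in> ring.span F" by (rule ring.span_scale[OF a(2)])
    finally show "c * y \<in> T" unfolding T_def using ring.subspace_scale[OF is_ideal_m a(1)] by blast
  qed
  moreover have "a * y \<in> T" if ay: "a \<in> m" "y \<in> ring.span (insert x F)" for a y
  proof -
    obtain k where "y - k * x \<in> ring.span F" using ay(2) by (auto simp: ring.span_insert)
    then have "a * (y - k * x) \<in> ring.span F" by (rule ring.span_scale)
    also have "a * (y - k * x) = a * y - (k * a) * x" by (simp add: algebra_simps)
    finally show ?thesis using ring.subspace_scale[OF is_ideal_m ay(1)] by (auto simp: T_def)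
  qed
  ultimately have "ideal_mult (*) m (ring.span (insert x F)) \<subseteq> T"
    unfolding ideal_mult_def by (intro ring.span_minimal) auto
  then obtain a where a: "a \<in> m" "x - a * x \<in> ring.span F" using insert.prems by (auto simp: T_def)
  obtain b where b: "b * (1 - a) = 1" using one_minus_unit[OF a(1)] by blast
  have "b * (x - a * x) = (b * (1 - a)) * x" by (simp add: algebra_simps)
  then have "x \<in> ring.span F" using ring.span_scale[OF a(2), of b] b by simp
  then have "ring.span (insert x F) = ring.span F"
    using ring.span_superset[of F] ring.span_mono[of F "insert x F"]
    by (intro subset_antisym ring.span_minimal) auto
  then show ?case using insert by simp
qed simp

text \<open>The descending chain of the powers of \<open>m\<close> becomes stationary at some \<open>I\<close> with \<open>m I = I\<close>. A vector
  space basis of \<open>I\<close> generates it as an ideal, so Nakayama's lemma applies.\<close>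

lemma m_nilpotent: "\<exists>s. ideal_power m s = {0}"
proof -
  obtain N where N: "\<forall>i\<ge>N. ideal_power m i = ideal_power m N"
    using artinian[of "ideal_power m"] is_ideal_ideal_power ideal_power_Suc_subset by blast
  define I where "I = ideal_power m N"
  have I: "is_ideal I" by (simp add: I_def is_ideal_ideal_power)
  have "ideal_power m (Suc N) = I" using N I_def by (meson le_SucI order_refl)
  then have mI: "ideal_mult (*) m I = I" by (simp add: I_def)
  obtain S where S: "finite S" "span S = UNIV" using finite_dim by blast
  then obtain X where X: "finite X" "X \<subseteq> I" "I \<subseteq> span X" "card X = dim I"
    using finite_spanning_subset[OF S(1), of I] by auto
  have "I \<subseteq> ring.span X"
    using X(3) span_minimal[OF ring.span_superset subspace_ideal[OF ring.subspace_span], of X] by blast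
  then have IX: "ring.span X = I" using X(2) ring.span_minimal[OF _ I] by blast
  then have "I = {0}" using nakayama[OF X(1)] X(2) mI by simp
  then show ?thesis unfolding I_def ..
qed

section \<open>The filtration by order\<close>

lemma linear_tuple_mult:
  "Vector_Spaces.linear (tuple_scale scale) (tuple_scale scale) (tuple_scale (*) l)"
proof -
  have "l * scale c x = scale c (l * x)" for c x by (metis scale_mult mult.commute)
  then show ?thesis
    unfolding Vector_Spaces.linear_iff using tup.vector_space_axioms
    by (simp add: tuple_scale_def fun_eq_iff distrib_left)
qed

text \<open>The unit vectors multiplied by the elements of a basis of the algebra.\<close>

lemma free_mod_finite_span: "\<exists>F. finite F \<and> free_mod n \<subseteq> tup.span F"
proof -
  obtain B where B: "finite B" "span B = UNIV" using finite_dim by blast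
  define e :: "nat \<Rightarrow> 'a \<Rightarrow> nat \<Rightarrow> 'a" where "e j b = (\<lambda>i. if i = j then b else 0)" for j b
  define F where "F = (\<Union>j<n. e j ` B)"
  have "x \<in> tup.span F" if x: "x \<in> free_mod n" for x
  proof -
    have ap: "(\<Sum>j\<in>A. g j) i = (\<Sum>j\<in>A. g j i)" for A and g :: "nat \<Rightarrow> nat \<Rightarrow> 'a" and i
      by (induction A rule: infinite_finite_induct) auto
    have "x = (\<Sum>j<n. e j (x j))"
    proof
      fix i
      show "x i = (\<Sum>j<n. e j (x j)) i" using x unfolding ap e_def free_mod_def by simp
    qed
    moreover have "e j (x j) \<in> tup.span F" if "j < n" for j
    proof -
      interpret e: Vector_Spaces.linear scale "tuple_scale scale" "e j"
        unfolding Vector_Spaces.linear_iff using vector_space_axioms tup.vector_space_axioms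
        by (auto simp: e_def tuple_scale_def fun_eq_iff)
      have "e j (x j) \<in> tup.span (e j ` B)" using e.span_image[of B] B(2) by simp
      then show ?thesis using tup.span_mono[of "e j ` B" F] that by (auto simp: F_def)
    qed
    ultimately show ?thesis using tup.span_sum[of "{..<n}" "\<lambda>j. e j (x j)" F] by simp
  qed
  moreover have "finite F" using B(1) by (simp add: F_def)
  ultimately show ?thesis by blast
qed

text \<open>The filtration is \<open>V i = M \<inter> m\<^sup>i A\<^sup>n\<close>, and the Hilbert function records its steps.\<close>

lemma jordan_type_le_hilbert_function:
  assumes M: "submodule_of_free n M" and l: "l \<in> m"
  shows "mult_jordan_type scale l M \<unlhd> conjugate_seq (hilbert_function scale m n M)"
proof -
  have Mn: "M \<subseteq> free_mod n" and Ms: "tuple.subspace M" using M by (auto simp: submodule_of_free_def)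
  obtain F where F: "finite F" "free_mod n \<subseteq> tup.span F" using free_mod_finite_span by blast
  obtain s where s: "ideal_power m s = {0}" using m_nilpotent by blast
  let ?f = "tuple_scale (*) l"
  define P where "P i = ideal_mult (tuple_scale (*)) (ideal_power m i) (free_mod n)" for i
  define V where "V = order_filtration m n M"
  have V: "V i = M \<inter> P i" for i by (simp add: V_def P_def order_filtration_def)
  have Ps: "tuple.subspace (P i)" for i by (simp add: P_def ideal_mult_def)
  have sub: "tup.subspace (V i)" for i
    unfolding V using Ms Ps by (intro subspace_tuple_submodule tuple.subspace_inter)
  have dec: "V (Suc i) \<subseteq> V i" for i
    unfolding V P_def
    using ideal_mult_mono[OF tuple.module_axioms ideal_power_Suc_subset subset_refl] by blast
  have V0: "V 0 = M"
  proof -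
    have "x \<in> P 0" if "x \<in> free_mod n" for x
      unfolding P_def ideal_mult_def
    proof (rule tuple.span_base)
      have "x = tuple_scale (*) 1 x" by simp
      then show "x \<in> {tuple_scale (*) a x |a x. a \<in> ideal_power m 0 \<and> x \<in> free_mod n}"
        using that by (metis (mono_tags, lifting) UNIV_I ideal_power.simps(1) mem_Collect_eq)
    qed
    then show ?thesis using Mn by (auto simp: V)
  qed
  have shift: "?f ` V i \<subseteq> V (Suc i)" for i
  proof -
    have "?f x \<in> P (Suc i)" if "x \<in> P i" for x
    proof -
      \<comment> \<open>The right-hand side is a submodule, so it suffices to look at the generators of \<open>P i\<close>.\<close>
      have "P i \<subseteq> {x. ?f x \<in> P (Suc i)}"
        unfolding P_def[of i] ideal_mult_def
      proof (rule tuple.span_minimal)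
        show "tuple.subspace {x. ?f x \<in> P (Suc i)}"
        proof (rule tuple.subspaceI)
          show "0 \<in> {x. ?f x \<in> P (Suc i)}" using tuple.subspace_0[OF Ps] by simp
        next
          fix x y assume "x \<in> {x. ?f x \<in> P (Suc i)}" "y \<in> {x. ?f x \<in> P (Suc i)}"
          then show "x + y \<in> {x. ?f x \<in> P (Suc i)}"
            using tuple.subspace_add[OF Ps] by (simp add: tuple.scale_right_distrib)
        next
          fix c x assume "x \<in> {x. ?f x \<in> P (Suc i)}"
          then have "tuple_scale (*) c (?f x) \<in> P (Suc i)" using tuple.subspace_scale[OF Ps] by blast
          then show "tuple_scale (*) c x \<in> {x. ?f x \<in> P (Suc i)}" by (simp add: mult.commute)
        qed
        show "{tuple_scale (*) a x |a x. a \<in> ideal_power m i \<and> x \<in> free_mod n} \<subseteq> {x. ?f x \<in> P (Suc i)}"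
        proof clarify
          fix a x assume ax: "a \<in> ideal_power m i" "(x :: nat \<Rightarrow> 'a) \<in> free_mod n"
          have "l * a \<in> ideal_power m (Suc i)"
            using l ax(1) by (auto simp: ideal_mult_def intro!: ring.span_base)
          then have "tuple_scale (*) (l * a) x \<in> P (Suc i)"
            unfolding P_def ideal_mult_def[of "tuple_scale (*)"] using ax(2)
            by (intro tuple.span_base) blast
          then show "?f (tuple_scale (*) a x) \<in> P (Suc i)" by simp
        qed
      qed
      then show ?thesis using that by blast
    qed
    then show ?thesis using tuple.subspace_scale[OF Ms] by (auto simp: V)
  qed
  have Vs: "V s \<subseteq> {0}"
  proof -
    have "{tuple_scale (*) a x |a x. a \<in> {0} \<and> x \<in> free_mod n} \<subseteq> {0 :: nat \<Rightarrow> 'a}" by auto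
    then have "P s \<subseteq> {0}" unfolding P_def s ideal_mult_def by (rule tuple.span_minimal) simp
    then show ?thesis by (auto simp: V)
  qed
  have VF: "V i \<subseteq> tup.span F" for i using V Mn F(2) by blast
  have h: "hilbert_function scale m n M i = tup.dim (V i) - tup.dim (V (Suc i))" for i
    unfolding hilbert_function_def V_def[symmetric]
    by (rule tup.quot_dim_eq_diff[OF sub sub dec F(1) VF])
  have "jordan_type (tuple_scale scale) (V 0) ?f \<unlhd> conjugate_seq (hilbert_function scale m n M)"
  proof (rule tup.jordan_type_dominance_le_conjugate_seq[where V = V and s = s, OF linear_tuple_mult F(1) VF sub dec shift Vs])
    show "tup.dim (V j) \<le> tup.dim (V (Suc j)) + hilbert_function scale m n M j" for j
      by (simp add: h)
    fix j assume "s \<le> j"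
    then have "V j \<subseteq> {0}" using lift_Suc_antimono_le[of V s j] dec Vs by blast
    then have "tup.dim (V j) = 0" using tup.dim_le_card[of "V j" "{}"] by auto
    then show "hilbert_function scale m n M j = 0" by (simp add: h)
  qed
  then show ?thesis by (simp add: mult_jordan_type_def V0)
qed

section \<open>The filtration by degree\<close>

text \<open>Both \<open>0\<close> and \<open>c\<close> represent the class of \<open>l = c \<cdot> 1\<close> in the residue field.\<close>

lemma degree_zero_in_m_eq_0:
  assumes "l \<in> m" "l \<in> range (\<lambda>c. scale c 1)"
  shows "l = 0"
proof -
  obtain c where c: "l = scale c 1" using assms(2) by blast
  have "0 - scale 0 1 \<in> m" "0 - scale (- c) 1 \<in> m"
    using ring.subspace_0[OF is_ideal_m] assms(1) c by auto
  then have "- c = 0" using residue_field[of 0] by blast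
  then show ?thesis using c by simp
qed

text \<open>The filtration is by degree: \<open>V j\<close> is the sum of the components of \<open>M\<close> of degree at least \<open>j\<close>.
  Its steps are bounded by the dimensions of the components, and it ends because almost all
  components of a finite-dimensional graded space vanish.\<close>

lemma jordan_type_le_weighted_hilbert_function:
  assumes M: "submodule_of_free n M" and l: "l \<in> m" "l \<in> G i"
    and G0: "G 0 = range (\<lambda>c. scale c 1)" and N: "module_grading scale G M N"
  shows "mult_jordan_type scale l M \<unlhd> conjugate_seq (weighted_hilbert_function scale N)"
proof -
  let ?f = "tuple_scale (*) l"
  have Mn: "M \<subseteq> free_mod n" and Ms: "tuple.subspace M" using M by (auto simp: submodule_of_free_def)
  have Msub: "tup.subspace M" by (rule subspace_tuple_submodule[OF Ms])
  obtain F where F: "finite F" "free_mod n \<subseteq> tup.span F" using free_mod_finite_span by blast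
  have MF: "M \<subseteq> tup.span F" using Mn F(2) by blast
  have D: "direct_sum_decomp (tuple_scale scale) M N"
    and act: "\<And>i j a x. a \<in> G i \<Longrightarrow> x \<in> N j \<Longrightarrow> tuple_scale (*) a x \<in> N (i + j)"
    using N by (auto simp: module_grading_def)
  have NM: "N a \<subseteq> M" for a using D by (auto simp: direct_sum_decomp_def)
  obtain s where s: "\<And>a. a \<ge> s \<Longrightarrow> N a \<subseteq> {0}"
    using tup.direct_sum_decomp_bounded[OF D F(1) MF] by blast
  define V where "V j = tup.span (\<Union>a\<in>{j..}. N a)" for j
  have VM: "V j \<subseteq> M" for j unfolding V_def using NM Msub by (intro tup.span_minimal) auto
  have VF: "V j \<subseteq> tup.span F" for j using VM MF by blast
  have sub: "tup.subspace (V j)" for j by (simp add: V_def)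
  have dec: "V (Suc j) \<subseteq> V j" for j unfolding V_def by (intro tup.span_mono UN_mono) auto
  have V0: "V 0 = M"
  proof
    show "M \<subseteq> V 0"
    proof
      fix v assume "v \<in> M"
      then obtain c where "\<forall>i. c i \<in> N i" and v: "v = (\<Sum>i | c i \<noteq> 0. c i)"
        using D unfolding direct_sum_decomp_def by blast
      then show "v \<in> V 0" unfolding V_def v by (intro tup.span_sum tup.span_base) auto
    qed
  qed (rule VM)
  interpret f: Vector_Spaces.linear "tuple_scale scale" "tuple_scale scale" ?f
    by (rule linear_tuple_mult)
  have shift: "?f ` V j \<subseteq> V (Suc j)" for j
  proof (cases "i = 0")
    case True
    then have "l = 0" using degree_zero_in_m_eq_0 l G0 by blast
    then show ?thesis using tup.subspace_0[OF sub] by auto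
  next
    case False
    have "?f ` N a \<subseteq> V (Suc j)" if "a \<ge> j" for a
    proof -
      have "N (i + a) \<subseteq> V (Suc j)" unfolding V_def
        using False that by (intro subset_trans[OF _ tup.span_superset]) (force intro: UN_upper)
      then show ?thesis using act[OF l(2)] by blast
    qed
    then have "?f ` (\<Union>a\<in>{j..}. N a) \<subseteq> V (Suc j)" by blast
    then show ?thesis
      unfolding V_def[of j] f.span_image[symmetric] by (rule tup.span_minimal[OF _ sub])
  qed
  have Vs: "V s \<subseteq> {0}" unfolding V_def using s by (intro tup.span_minimal) auto
  have "jordan_type (tuple_scale scale) (V 0) ?f \<unlhd> conjugate_seq (weighted_hilbert_function scale N)"
  proof (rule tup.jordan_type_dominance_le_conjugate_seq[where V = V and s = s, OF linear_tuple_mult F(1) VF sub dec shift Vs])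
    fix j
    have "{j..} = insert j {Suc j..}" by auto
    then have "(\<Union>a\<in>{j..}. N a) \<subseteq> N j \<union> V (Suc j)"
      unfolding V_def using tup.span_superset[of "\<Union>a\<in>{Suc j..}. N a"] by auto
    then have "V j \<subseteq> tup.span (N j \<union> V (Suc j))" unfolding V_def[of j] by (rule tup.span_mono)
    moreover have "N j \<union> V (Suc j) \<subseteq> tup.span F" using NM MF VF by blast
    then have "tup.span (N j \<union> V (Suc j)) \<subseteq> tup.span F" by (rule tup.span_minimal) simp
    ultimately have "tup.dim (V j) \<le> tup.dim (tup.span (N j \<union> V (Suc j)))"
      using F(1) by (intro tup.dim_mono_subset)
    also have "\<dots> \<le> tup.dim (N j) + tup.dim (V (Suc j))"
      using NM MF VF by (intro tup.dim_span_Un_le[OF F(1)]) blast+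
    finally show "tup.dim (V j) \<le> tup.dim (V (Suc j)) + weighted_hilbert_function scale N j"
      by (simp add: weighted_hilbert_function_def)
  next
    fix j assume "s \<le> j"
    then show "weighted_hilbert_function scale N j = 0"
      unfolding weighted_hilbert_function_def using s tup.dim_le_card[of "N j" "{}"] by auto
  qed
  then show ?thesis by (simp add: mult_jordan_type_def V0)
qed

end

theorem theorem2p5:
  fixes scale :: "'k::field \<Rightarrow> 'a::comm_ring_1 \<Rightarrow> 'a" and m :: "'a set"
    and n :: nat and M :: "(nat \<Rightarrow> 'a) set"
  assumes "local_artinian_algebra scale m"
    and "submodule_of_free n M"
  shows "(\<forall>l\<in>m. mult_jordan_type scale l M \<unlhd> conjugate_seq (hilbert_function scale m n M)) \<and>
    (\<forall>G N. algebra_grading scale G \<and> G 0 = range (\<lambda>c. scale c 1) \<and> module_grading scale G M N \<longrightarrow>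
      (\<forall>l\<in>m. (\<exists>i. l \<in> G i) \<longrightarrow>
        mult_jordan_type scale l M \<unlhd> conjugate_seq (weighted_hilbert_function scale N)))"
proof -
  interpret local_artinian_algebra scale m by fact
  show ?thesis
    using jordan_type_le_hilbert_function[OF assms(2)]
      jordan_type_le_weighted_hilbert_function[OF assms(2)] by blast
qed

end
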